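(* Let $\Gamma$ be an infinite finitely generated discrete group with polynomial growth of exponent $r\ge 1$, equipped with the word length function $\ell$ relative to a finite generating set $S$. Then for any natural number $k>\frac r2$, $(C^*_r(\Gamma),L^k_\ell)$ is a compact quantum metric space and $$\frac1k\;\le\;\mathrm{Mdim}_{L^k_\ell}(C^*_r(\Gamma))\;\le\;\frac{2r}{2k-r}.$$
   Context: $\Gamma$ has polynomial growth with growth exponent $r\ge1$ if there is $C>0$ such that $|\{g\in\Gamma:\ell(g)\le n\}|\le C(1+n)^r$ for all $n\in\mathbb N$. $C^*_r(\Gamma)$ is the reduced group $C^*$-algebra, $\lambda$ is its (left regular) representation on $\ell^2(\Gamma)$, and $C_c(\Gamma)$ is the dense $*$-subalgebra of finitely supported functions $\sum c_g\delta_g$ (with convolution product). $M_\ell$ is the unbounded operator on $\ell^2(\Gamma)$ with domain $C_c(\Gamma)$, $M_\ell(\sum c_g\delta_g)=\sum\ell(g)c_g\delta_g$. For $f\in C_c(\Gamma)$, $\Delta^1_\ell(f)=[M_\ell,\lambda(f)]$ and $\Delta^k_\ell(f)=[M_\ell,\Delta^{k-1}_\ell(f)]$; these extend to bounded operators on $\ell^2(\Gamma)$. The seminorm $L^k_\ell:C^*_r(\Gamma)\to[0,+\infty]$ is $L^k_\ell(f)=\|\Delta^k_\ell(f)\|_{\mathrm{op}}$ for $f\in C_c(\Gamma)$ and $L^k_\ell=+\infty$ off $C_c(\Gamma)$. A compact quantum metric space is a pair $(A,L)$ with $A$ a unital $C^*$-algebra and $L:A\to[0,+\infty]$ a seminorm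 (possibly taking the value $+\infty$) such that: for distinct states $\phi,\psi\in S(A)$ there is $a$ with $L(a)<+\infty$ and $\phi(a)\ne\psi(a)$; $L(a^* )=L(a)$ for all $a$; $\ker L=\mathbb C1_A$; and the metric $d_L(\phi,\psi)=\sup\{|\phi(a)-\psi(a)|:L(a)<1\}$ induces the weak-$*$ topology on $S(A)$. For a subset $Y$ of a normed space $X$ and $\delta>0$, $D(Y,\delta)$ is the infimum of $\dim Z$ over finite-dimensional subspaces $Z\subseteq X$ such that for every $y\in Y$ there is $z\in Z$ with $\|y-z\|<\delta$. The metric dimension is $\mathrm{Mdim}_L(A)=\limsup_{\delta\to0^+}\frac{\log D(\mathcal L_1,\delta)}{\log\delta^{-1}}$, where $\mathcal L_1=\{a\in A:L(a)<1\}$. *)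

theory Defs
  imports "HOL-Analysis.Analysis"
begin

section \<open>The Hilbert space of square-summable functions\<close>

definition square_summable :: "('g \<Rightarrow> complex) \<Rightarrow> bool" where
  "square_summable x \<longleftrightarrow> (\<lambda>g. (cmod (x g))\<^sup>2) summable_on UNIV"

definition l2norm :: "('g \<Rightarrow> complex) \<Rightarrow> real" where
  "l2norm x = sqrt (\<Sum>\<^sub>\<infinity>g. (cmod (x g))\<^sup>2)"

lemma L2_set_le_l2norm:
  assumes "square_summable x" "finite F"
  shows "L2_set (\<lambda>g. cmod (x g)) F \<le> l2norm x"
  unfolding L2_set_def l2norm_def
  using assms by (auto simp: square_summable_def intro!: finite_sum_le_infsum)

lemma square_summable_l2normI:
  assumes "\<And>F. finite F \<Longrightarrow> L2_set (\<lambda>g. cmod (x g)) F \<le> b"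
  shows "square_summable x" "l2norm x \<le> b"
proof -
  have b: "0 \<le> b" using assms[of "{}"] by simp
  have le: "(\<Sum>g\<in>F. (cmod (x g))\<^sup>2) \<le> b\<^sup>2" if "finite F" for F
    using assms[OF that] unfolding L2_set_def
    by (metis real_sqrt_le_iff real_sqrt_unique b)
  show sx: "square_summable x"
    unfolding square_summable_def
    by (rule nonneg_bdd_above_summable_on) (auto intro!: bdd_aboveI[of _ "b\<^sup>2"] le)
  have "(\<Sum>\<^sub>\<infinity>g. (cmod (x g))\<^sup>2) \<le> b\<^sup>2"
    using sx unfolding square_summable_def by (rule infsum_le_finite_sums) (rule le)
  then show "l2norm x \<le> b"
    unfolding l2norm_def using b real_le_lsqrt by blast
qed

lemma square_summable_add:
  assumes "square_summable x" "square_summable y"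
  shows "square_summable (\<lambda>g. x g + y g)" "l2norm (\<lambda>g. x g + y g) \<le> l2norm x + l2norm y"
proof -
  have "L2_set (\<lambda>g. cmod (x g + y g)) F \<le> l2norm x + l2norm y" if "finite F" for F
  proof -
    have "L2_set (\<lambda>g. cmod (x g + y g)) F \<le> L2_set (\<lambda>g. cmod (x g) + cmod (y g)) F"
      by (rule L2_set_mono) (auto intro: norm_triangle_ineq)
    also have "\<dots> \<le> L2_set (\<lambda>g. cmod (x g)) F + L2_set (\<lambda>g. cmod (y g)) F"
      by (rule L2_set_triangle_ineq)
    also have "\<dots> \<le> l2norm x + l2norm y"
      using assms that by (intro add_mono L2_set_le_l2norm)
    finally show ?thesis .
  qed
  from square_summable_l2normI[of "\<lambda>g. x g + y g", OF this]
  show "square_summable (\<lambda>g. x g + y g)" "l2norm (\<lambda>g. x g + y g) \<le> l2norm x + l2norm y"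
    by blast+
qed

lemma square_summable_cmult:
  assumes "square_summable x"
  shows "square_summable (\<lambda>g. c * x g)"
  using assms unfolding square_summable_def
  by (simp add: norm_mult power_mult_distrib summable_on_cmult_right)

lemma l2norm_cmult: "l2norm (\<lambda>g. c * x g) = cmod c * l2norm x"
  by (simp add: l2norm_def norm_mult power_mult_distrib infsum_cmult_right' real_sqrt_mult)

lemma square_summable_finite:
  assumes "finite {g. x g \<noteq> 0}"
  shows "square_summable x"
  unfolding square_summable_def
  by (rule finite_nonzero_values_imp_summable_on) (use assms in \<open>auto elim: rev_finite_subset\<close>)

typedef 'g ell2 = "{x :: 'g \<Rightarrow> complex. square_summable x}"
  morphisms coeff Abs_ell2
  by (rule exI[of _ "\<lambda>_. 0"]) (simp add: square_summable_finite)

setup_lifting type_definition_ell2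

instantiation ell2 :: (type) real_normed_vector
begin

lift_definition zero_ell2 :: "'a ell2" is "\<lambda>_. 0"
  by (simp add: square_summable_finite)

lift_definition plus_ell2 :: "'a ell2 \<Rightarrow> 'a ell2 \<Rightarrow> 'a ell2" is "\<lambda>x y g. x g + y g"
  by (rule square_summable_add)

lift_definition uminus_ell2 :: "'a ell2 \<Rightarrow> 'a ell2" is "\<lambda>x g. - x g"
  by (simp add: square_summable_def)

lift_definition minus_ell2 :: "'a ell2 \<Rightarrow> 'a ell2 \<Rightarrow> 'a ell2" is "\<lambda>x y g. x g - y g"
proof -
  fix x y :: "'a \<Rightarrow> complex"
  assume "square_summable x" "square_summable y"
  then show "square_summable (\<lambda>g. x g - y g)"
    using square_summable_add(1)[of x "\<lambda>g. (-1) * y g"] square_summable_cmult[of y "-1"] by simp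
qed

lift_definition scaleR_ell2 :: "real \<Rightarrow> 'a ell2 \<Rightarrow> 'a ell2" is "\<lambda>r x g. of_real r * x g"
  by (rule square_summable_cmult)

lift_definition norm_ell2 :: "'a ell2 \<Rightarrow> real" is l2norm .

definition dist_ell2 :: "'a ell2 \<Rightarrow> 'a ell2 \<Rightarrow> real" where
  "dist_ell2 x y = norm (x - y)"

definition sgn_ell2 :: "'a ell2 \<Rightarrow> 'a ell2" where
  "sgn_ell2 x = inverse (norm x) *\<^sub>R x"

definition uniformity_ell2 :: "('a ell2 \<times> 'a ell2) filter" where
  "uniformity_ell2 = (INF e\<in>{0<..}. principal {(x, y). dist x y < e})"

definition open_ell2 :: "'a ell2 set \<Rightarrow> bool" where
  "open_ell2 U \<longleftrightarrow> (\<forall>x\<in>U. eventually (\<lambda>(x', y). x' = x \<longrightarrow> y \<in> U) uniformity)"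

instance
proof
  fix x y z :: "'a ell2" and a b :: real
  show "x + y + z = x + (y + z)" by transfer (simp add: add.assoc)
  show "x + y = y + x" by transfer (simp add: add.commute)
  show "0 + x = x" by transfer simp
  show "- x + x = 0" by transfer simp
  show "x - y = x + - y" by transfer simp
  show "a *\<^sub>R (x + y) = a *\<^sub>R x + a *\<^sub>R y" by transfer (simp add: distrib_left)
  show "(a + b) *\<^sub>R x = a *\<^sub>R x + b *\<^sub>R x" by transfer (simp add: distrib_right)
  show "a *\<^sub>R b *\<^sub>R x = (a * b) *\<^sub>R x" by transfer (simp add: mult.assoc)
  show "1 *\<^sub>R x = x" by transfer simp
  show "norm x = 0 \<longleftrightarrow> x = 0"
  proof transfer
    fix x :: "'a \<Rightarrow> complex"
    assume x: "square_summable x"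
    show "l2norm x = 0 \<longleftrightarrow> x = (\<lambda>_. 0)"
    proof
      assume "l2norm x = 0"
      then have "cmod (x g) \<le> 0" for g
        using L2_set_le_l2norm[OF x, of "{g}"] by simp
      then show "x = (\<lambda>_. 0)" by auto
    qed (simp add: l2norm_def)
  qed
  show "norm (x + y) \<le> norm x + norm y" by transfer (rule square_summable_add)
  show "norm (a *\<^sub>R x) = \<bar>a\<bar> * norm x" by transfer (simp add: l2norm_cmult)
qed (simp_all add: dist_ell2_def sgn_ell2_def uniformity_ell2_def open_ell2_def)

end

lift_definition cscale :: "complex \<Rightarrow> 'g ell2 \<Rightarrow> 'g ell2" is "\<lambda>c x g. c * x g"
  by (rule square_summable_cmult)

definition cinner :: "'g ell2 \<Rightarrow> 'g ell2 \<Rightarrow> complex" where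
  "cinner x y = (\<Sum>\<^sub>\<infinity>g. cnj (coeff x g) * coeff y g)"

text \<open>The dense subspace of finitely supported functions.\<close>

definition Cc :: "'g ell2 set" where
  "Cc = {x. finite {g. coeff x g \<noteq> 0}}"


section \<open>The reduced group algebra\<close>

text \<open>
  Groups are types of class \<open>group_add\<close>, which is not assumed commutative; so \<open>g + h\<close> is the
  group product, \<open>- g\<close> the inverse and \<open>0\<close> the neutral element.
\<close>

lift_definition translation :: "'g::group_add \<Rightarrow> 'g ell2 \<Rightarrow> 'g ell2" is "\<lambda>g x h. x (- g + h)"
proof -
  fix g :: 'g and x :: "'g \<Rightarrow> complex"
  assume "square_summable x"
  moreover have "bij (\<lambda>h. - g + h)"
    by (rule o_bij[of "\<lambda>h. g + h"]) (auto simp: fun_eq_iff add.assoc[symmetric])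
  ultimately show "square_summable (\<lambda>h. x (- g + h))"
    unfolding square_summable_def
    by (subst summable_on_reindex_bij_betw[of "\<lambda>h. - g + h" UNIV UNIV]) auto
qed

lemma norm_translation: "norm (translation g x) = norm x"
proof (transfer fixing: g)
  fix x :: "'a \<Rightarrow> complex"
  have "bij (\<lambda>h. - g + h)"
    by (rule o_bij[of "\<lambda>h. g + h"]) (auto simp: fun_eq_iff add.assoc[symmetric])
  then show "l2norm (\<lambda>h. x (- g + h)) = l2norm x"
    unfolding l2norm_def
    by (subst infsum_reindex_bij_betw[of "\<lambda>h. - g + h" UNIV UNIV]) auto
qed

lemma bounded_linear_translation: "bounded_linear (translation g)"
proof (rule bounded_linear_intro[where K = 1])
  fix x y :: "'a ell2" and r :: real
  show "translation g (x + y) = translation g x + translation g y" by transfer simp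
  show "translation g (r *\<^sub>R x) = r *\<^sub>R translation g x" by transfer simp
  show "norm (translation g x) \<le> norm x * 1" by (simp add: norm_translation)
qed

text \<open>
  The type \<open>'g ell2 \<Rightarrow>\<^sub>L 'g ell2\<close> consists of the real-linear bounded operators; its norm is
  the operator norm.  All operators considered below are complex-linear.
\<close>

lemma bounded_linear_cscale: "bounded_linear (cscale c)"
proof (rule bounded_linear_intro[where K = "cmod c"])
  fix x y :: "'g ell2" and r :: real
  show "cscale c (x + y) = cscale c x + cscale c y" by transfer (simp add: distrib_left)
  show "cscale c (r *\<^sub>R x) = r *\<^sub>R cscale c x" by transfer (simp add: mult.left_commute)
  show "norm (cscale c x) \<le> norm x * cmod c" by transfer (simp add: l2norm_cmult mult.commute)
qed

definition unitary_translation :: "'g::group_add \<Rightarrow> 'g ell2 \<Rightarrow>\<^sub>L 'g ell2" where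
  "unitary_translation g = Blinfun (translation g)"

lemma unitary_translation_apply [simp]: "blinfun_apply (unitary_translation g) = translation g"
  by (simp add: unitary_translation_def bounded_linear_Blinfun_apply bounded_linear_translation)

definition cscale_op :: "complex \<Rightarrow> ('g ell2 \<Rightarrow>\<^sub>L 'g ell2) \<Rightarrow> ('g ell2 \<Rightarrow>\<^sub>L 'g ell2)" where
  "cscale_op c T = Blinfun (\<lambda>x. cscale c (blinfun_apply T x))"

lemma cscale_op_apply [simp]: "blinfun_apply (cscale_op c T) x = cscale c (blinfun_apply T x)"
  by (simp add: cscale_op_def bounded_linear_Blinfun_apply bounded_linear_compose[OF bounded_linear_cscale]
      blinfun.bounded_linear_right)

text \<open>The left regular representation: \<open>lreg f\<close> is left convolution by \<open>f \<in> Cc\<close>.\<close>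

definition lreg :: "'g::group_add ell2 \<Rightarrow> ('g ell2 \<Rightarrow>\<^sub>L 'g ell2)" where
  "lreg f = (\<Sum>g | coeff f g \<noteq> 0. cscale_op (coeff f g) (unitary_translation g))"

definition adjoint_op :: "('g ell2 \<Rightarrow>\<^sub>L 'g ell2) \<Rightarrow> ('g ell2 \<Rightarrow>\<^sub>L 'g ell2)" where
  "adjoint_op T = (THE R. \<forall>x y. cinner (blinfun_apply R x) y = cinner x (blinfun_apply T y))"


section \<open>Unital C*-algebras, states and compact quantum metric spaces\<close>

text \<open>
  A unital C*-algebra is given by a carrier in an ambient complex normed vector space, from which
  it inherits addition and norm.
\<close>

record 'b cstar =
  carrier :: "'b set"
  smult :: "complex \<Rightarrow> 'b \<Rightarrow> 'b"
  mult :: "'b \<Rightarrow> 'b \<Rightarrow> 'b"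
  unit :: "'b"
  star :: "'b \<Rightarrow> 'b"

locale unital_cstar_algebra =
  fixes A :: "'b::real_normed_vector cstar"
  assumes vector_space_smult: "vector_space (smult A)"
    and smult_of_real: "smult A (of_real t) x = t *\<^sub>R x"
    and norm_smult: "norm (smult A z x) = cmod z * norm x"
    and subspace_carrier: "module.subspace (smult A) (carrier A)"
    and complete_carrier: "complete (carrier A)"
    and unit_closed: "unit A \<in> carrier A"
    and mult_closed: "\<lbrakk>a \<in> carrier A; b \<in> carrier A\<rbrakk> \<Longrightarrow> mult A a b \<in> carrier A"
    and star_closed: "a \<in> carrier A \<Longrightarrow> star A a \<in> carrier A"
    and mult_assoc: "\<lbrakk>a \<in> carrier A; b \<in> carrier A; c \<in> carrier A\<rbrakk> \<Longrightarrow>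
          mult A (mult A a b) c = mult A a (mult A b c)"
    and mult_unit_left: "a \<in> carrier A \<Longrightarrow> mult A (unit A) a = a"
    and mult_unit_right: "a \<in> carrier A \<Longrightarrow> mult A a (unit A) = a"
    and mult_add_left: "\<lbrakk>a \<in> carrier A; b \<in> carrier A; c \<in> carrier A\<rbrakk> \<Longrightarrow>
          mult A (a + b) c = mult A a c + mult A b c"
    and mult_add_right: "\<lbrakk>a \<in> carrier A; b \<in> carrier A; c \<in> carrier A\<rbrakk> \<Longrightarrow>
          mult A a (b + c) = mult A a b + mult A a c"
    and mult_smult_left: "\<lbrakk>a \<in> carrier A; b \<in> carrier A\<rbrakk> \<Longrightarrow>
          mult A (smult A z a) b = smult A z (mult A a b)"
    and mult_smult_right: "\<lbrakk>a \<in> carrier A; b \<in> carrier A\<rbrakk> \<Longrightarrow>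
          mult A a (smult A z b) = smult A z (mult A a b)"
    and star_star: "a \<in> carrier A \<Longrightarrow> star A (star A a) = a"
    and star_add: "\<lbrakk>a \<in> carrier A; b \<in> carrier A\<rbrakk> \<Longrightarrow> star A (a + b) = star A a + star A b"
    and star_smult: "a \<in> carrier A \<Longrightarrow> star A (smult A z a) = smult A (cnj z) (star A a)"
    and star_mult: "\<lbrakk>a \<in> carrier A; b \<in> carrier A\<rbrakk> \<Longrightarrow> star A (mult A a b) = mult A (star A b) (star A a)"
    and norm_mult_le: "\<lbrakk>a \<in> carrier A; b \<in> carrier A\<rbrakk> \<Longrightarrow> norm (mult A a b) \<le> norm a * norm b"
    and cstar_identity: "a \<in> carrier A \<Longrightarrow> norm (mult A (star A a) a) = (norm a)\<^sup>2"

text \<open>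
  A state is a positive linear functional of norm one.  States are functions on the carrier,
  hence extensional.
\<close>

definition states :: "'b::real_normed_vector cstar \<Rightarrow> ('b \<Rightarrow> complex) set" where
  "states A = {\<phi> \<in> extensional (carrier A).
     (\<forall>a\<in>carrier A. \<forall>b\<in>carrier A. \<phi> (a + b) = \<phi> a + \<phi> b) \<and>
     (\<forall>c. \<forall>a\<in>carrier A. \<phi> (smult A c a) = c * \<phi> a) \<and>
     (\<forall>a\<in>carrier A. \<phi> (mult A (star A a) a) \<in> \<real>\<^sub>\<ge>\<^sub>0) \<and>
     (SUP a\<in>{a \<in> carrier A. norm a \<le> 1}. ennreal (cmod (\<phi> a))) = 1}"

text \<open>The weak-* topology is the topology of pointwise convergence on the carrier.\<close>

definition weak_star_topology :: "'b::real_normed_vector cstar \<Rightarrow> ('b \<Rightarrow> complex) topology" where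
  "weak_star_topology A =
     subtopology (product_topology (\<lambda>_. euclidean) (carrier A)) (states A)"

definition is_seminorm :: "'b::real_normed_vector cstar \<Rightarrow> ('b \<Rightarrow> ennreal) \<Rightarrow> bool" where
  "is_seminorm A L \<longleftrightarrow>
     (\<forall>a\<in>carrier A. \<forall>b\<in>carrier A. L (a + b) \<le> L a + L b) \<and>
     (\<forall>c. \<forall>a\<in>carrier A. L (smult A c a) = ennreal (cmod c) * L a)"

definition unit_ball :: "'b::real_normed_vector cstar \<Rightarrow> ('b \<Rightarrow> ennreal) \<Rightarrow> 'b set" where
  "unit_ball A L = {a \<in> carrier A. L a < 1}"

definition state_dist ::
    "'b::real_normed_vector cstar \<Rightarrow> ('b \<Rightarrow> ennreal) \<Rightarrow> ('b \<Rightarrow> complex) \<Rightarrow> ('b \<Rightarrow> complex) \<Rightarrow> ennreal" where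
  "state_dist A L \<phi> \<psi> = (SUP a\<in>unit_ball A L. ennreal (cmod (\<phi> a - \<psi> a)))"

definition compact_quantum_metric_space ::
    "'b::real_normed_vector cstar \<Rightarrow> ('b \<Rightarrow> ennreal) \<Rightarrow> bool" where
  "compact_quantum_metric_space A L \<longleftrightarrow>
     unital_cstar_algebra A \<and>
     is_seminorm A L \<and>
     (\<forall>\<phi>\<in>states A. \<forall>\<psi>\<in>states A. \<phi> \<noteq> \<psi> \<longrightarrow> (\<exists>a\<in>carrier A. L a < \<infinity> \<and> \<phi> a \<noteq> \<psi> a)) \<and>
     (\<forall>a\<in>carrier A. L (star A a) = L a) \<and>
     {a \<in> carrier A. L a = 0} = range (\<lambda>c. smult A c (unit A)) \<and>
     (\<forall>\<phi>\<in>states A. \<forall>\<psi>\<in>states A. state_dist A L \<phi> \<psi> < \<infinity>) \<and>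
     Metric_space (states A) (\<lambda>\<phi> \<psi>. enn2real (state_dist A L \<phi> \<psi>)) \<and>
     Metric_space.mtopology (states A) (\<lambda>\<phi> \<psi>. enn2real (state_dist A L \<phi> \<psi>)) =
       weak_star_topology A"


section \<open>Metric dimension\<close>

text \<open>Dimensions are complex dimensions; the infimum is \<open>\<infinity>\<close> if no finite-dimensional subspace works.\<close>

definition approx_dim :: "'b::real_normed_vector cstar \<Rightarrow> 'b set \<Rightarrow> real \<Rightarrow> enat" where
  "approx_dim A Y \<delta> = Inf {enat (vector_space.dim (smult A) Z) | Z.
     Z \<subseteq> carrier A \<and> (\<exists>B. finite B \<and> Z = module.span (smult A) B) \<and>
     (\<forall>y\<in>Y. \<exists>z\<in>Z. norm (y - z) < \<delta>)}"

definition ln_enat :: "enat \<Rightarrow> ereal" where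
  "ln_enat n = (case n of enat m \<Rightarrow> if m = 0 then - \<infinity> else ereal (ln (real m)) | \<infinity> \<Rightarrow> \<infinity>)"

definition metric_dim :: "'b::real_normed_vector cstar \<Rightarrow> ('b \<Rightarrow> ennreal) \<Rightarrow> ereal" where
  "metric_dim A L =
     Limsup (at_right 0) (\<lambda>\<delta>. ln_enat (approx_dim A (unit_ball A L) \<delta>) / ereal (ln (1 / \<delta>)))"


section \<open>The reduced group C*-algebra and the seminorms given by a length function\<close>

definition reduced_group_cstar :: "('g::group_add ell2 \<Rightarrow>\<^sub>L 'g ell2) cstar" where
  "reduced_group_cstar =
     \<lparr>carrier = closure (lreg ` Cc), smult = cscale_op, mult = (o\<^sub>L), unit = id_blinfun,
      star = adjoint_op\<rparr>"

text \<open>The domain of this operator is \<open>Cc\<close>; the value \<open>0\<close> elsewhere is never used.\<close>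

lift_definition mult_length :: "('g \<Rightarrow> real) \<Rightarrow> 'g ell2 \<Rightarrow> 'g ell2"
  is "\<lambda>l x g. if finite {h. x h \<noteq> 0} then of_real (l g) * x g else 0"
proof -
  fix l :: "'g \<Rightarrow> real" and x :: "'g \<Rightarrow> complex"
  show "square_summable (\<lambda>g. if finite {h. x h \<noteq> 0} then of_real (l g) * x g else 0)"
    by (cases "finite {h. x h \<noteq> 0}") (auto intro!: square_summable_finite elim: rev_finite_subset)
qed

text \<open>
  The bounded extension to the whole space of the commutator of \<open>mult_length l\<close> with \<open>T\<close>, which is
  defined on \<open>Cc\<close> when \<open>T\<close> preserves \<open>Cc\<close>.  It is unique as \<open>Cc\<close> is dense.  For \<open>f \<in> Cc\<close>, the
  \<open>k\<close>-fold iterate of this operation at \<open>lreg f\<close> is the iterated commutator \<open>[M, [M, \<dots> [M, \<lambda>(f)]]]\<close>.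
\<close>

definition length_commutator :: "('g \<Rightarrow> real) \<Rightarrow> ('g ell2 \<Rightarrow>\<^sub>L 'g ell2) \<Rightarrow> ('g ell2 \<Rightarrow>\<^sub>L 'g ell2)" where
  "length_commutator l T = (THE R. \<forall>x\<in>Cc. blinfun_apply R x =
     mult_length l (blinfun_apply T x) - blinfun_apply T (mult_length l x))"

text \<open>Finitely supported functions \<open>f\<close> are identified with the operators \<open>lreg f\<close>.\<close>

definition length_seminorm :: "('g::group_add \<Rightarrow> real) \<Rightarrow> nat \<Rightarrow> ('g ell2 \<Rightarrow>\<^sub>L 'g ell2) \<Rightarrow> ennreal" where
  "length_seminorm l k T =
     (if T \<in> lreg ` Cc then ennreal (norm ((length_commutator l ^^ k) T)) else \<infinity>)"


section \<open>Word length and growth\<close>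

definition words :: "'g::group_add set \<Rightarrow> 'g list set" where
  "words S = lists (S \<union> uminus ` S)"

definition generates_group :: "'g::group_add set \<Rightarrow> bool" where
  "generates_group S \<longleftrightarrow> (\<forall>g. \<exists>w\<in>words S. sum_list w = g)"

definition word_length :: "'g::group_add set \<Rightarrow> 'g \<Rightarrow> real" where
  "word_length S g = real (LEAST n. \<exists>w\<in>words S. length w = n \<and> sum_list w = g)"

text \<open>Finiteness is required explicitly since \<open>card\<close> of an infinite set is \<open>0\<close>.\<close>

definition polynomial_growth :: "('g \<Rightarrow> real) \<Rightarrow> real \<Rightarrow> bool" where
  "polynomial_growth l r \<longleftrightarrow> (\<exists>C>0. \<forall>n::nat.
     finite {g. l g \<le> real n} \<and> real (card {g. l g \<le> real n}) \<le> C * (1 + real n) powr r)"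

end

(*
  Write |f|_{2,k} for the l2-norm of g |-> l(g)^k f(g).  The operator Delta^k(f) has matrix entries
  (l(g) - l(h))^k f(g h^-1); applying it to delta_e gives L^k(f) >= |f|_{2,k}.  Since 2k > r,
  polynomial growth and Cauchy-Schwarz bound the l1-norm of the part of f outside the n-ball by
  const * n^-((2k-r)/2) * L^k(f).

  This tail estimate bounds d_L(phi, psi) by the sum of |phi - psi|(lambda_g) over the n-ball, plus an
  error that tends to 0 with n; hence d_L is finite and weak-* continuous.  It also shows that the
  span of the n-ball approximates the unit ball of L^k, which gives the upper bound on the dimension.

  For the lower bound, (1/(2 n^k)) lambda_g lies in the unit ball of L^k whenever l(g) <= n, and an
  infinite group has at least n+1 such g.  Evaluating at delta_e, a subspace that approximates these
  elements yields one of l2 that is within 1/2 of n+1 orthonormal vectors, so its dimension is at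
  least 3(n+1)/4 by Bessel's inequality.
*)

theory Submission
  imports Defs "HOL-Real_Asymp.Real_Asymp"
begin

section \<open>The Hilbert space\<close>

text \<open>The seminorm does not see the coefficient at the neutral element, where the weight
  \<open>l 0 ^ k\<close> vanishes. This does no harm: states agree on the unit, because positivity
  and norm one force the value 1 there, and the unit lies in the span of every ball. Commutators and
  adjoints are definite descriptions, so operators that realize them must be exhibited.
  Multiplication by l is unbounded, but its commutator with the translation by g merely inserts the
  weights l(h) - l(g^-1 h), which the triangle inequality bounds by l(g). Adjoints of finitely
  supported elements are explicit, and those of limits are limits. The metric d_L is at least as
  fine as the weak-* topology because L^k is finite on the dense group algebra and states are
  contractive. The exponents come from solving for the radius n: for the upper bound n^-((2k-r)/2)
  is of order \<delta> and the ball has O(n^r) elements; for the lower bound 4 n^k \<delta> = 1 up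
  to rounding, against n+1 elements.\<close>

lemma square_summable_coeff [simp]: "square_summable (coeff x)"
  using coeff[of x] by simp

lemma ell2_eqI: "(\<And>g. coeff x g = coeff y g) \<Longrightarrow> x = y"
  by (simp add: coeff_inject[symmetric] fun_eq_iff)

lemma coeff_simps [simp]:
  "coeff 0 g = 0" "coeff (x + y) g = coeff x g + coeff y g"
  "coeff (x - y) g = coeff x g - coeff y g" "coeff (- x) g = - coeff x g"
  "coeff (t *\<^sub>R x) g = of_real t * coeff x g" "coeff (cscale c x) g = c * coeff x g"
  by (simp_all add: zero_ell2.rep_eq plus_ell2.rep_eq minus_ell2.rep_eq uminus_ell2.rep_eq
      scaleR_ell2.rep_eq cscale.rep_eq)

lemma coeff_translation [simp]: "coeff (translation g x) h = coeff x (- g + h)"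
  by (simp add: translation.rep_eq)

lemma coeff_sum: "coeff (sum f I) g = (\<Sum>i\<in>I. coeff (f i) g)"
  by (induction I rule: infinite_finite_induct) auto

lemma coeff_Abs_ell2: "square_summable x \<Longrightarrow> coeff (Abs_ell2 x) = x"
  by (simp add: Abs_ell2_inverse)

lemma L2_set_coeff_le_norm: "finite F \<Longrightarrow> L2_set (\<lambda>g. cmod (coeff x g)) F \<le> norm x"
  by (simp add: norm_ell2.rep_eq L2_set_le_l2norm)

lemma cmod_coeff_le_norm: "cmod (coeff x g) \<le> norm x"
  using L2_set_coeff_le_norm[of "{g}" x] by simp

lemma norm_ell2_leI:
  "(\<And>F. finite F \<Longrightarrow> L2_set (\<lambda>g. cmod (coeff x g)) F \<le> b) \<Longrightarrow> norm x \<le> b"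
  by (simp add: norm_ell2.rep_eq square_summable_l2normI(2))

lemma cscale_simps [simp]:
  "cscale 0 x = 0" "cscale 1 x = x" "cscale c 0 = 0" "cscale c (cscale d x) = cscale (c * d) x"
  by (auto intro!: ell2_eqI)

lemma cscale_of_real: "cscale (of_real t) x = t *\<^sub>R x"
  by (auto intro!: ell2_eqI)

lemma cscale_add_left: "cscale (c + d) x = cscale c x + cscale d x"
  by (auto intro!: ell2_eqI simp: algebra_simps)

lemma cscale_add_right: "cscale c (x + y) = cscale c x + cscale c y"
  by (auto intro!: ell2_eqI simp: algebra_simps)

lemma cscale_diff_right: "cscale c (x - y) = cscale c x - cscale c y"
  by (auto intro!: ell2_eqI simp: algebra_simps)

lemma norm_cscale: "norm (cscale c x) = cmod c * norm x"
  by (simp add: norm_ell2.rep_eq cscale.rep_eq l2norm_cmult)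

section \<open>Inner product and Cauchy-Schwarz inequality\<close>

lemma sum_cnj_mult_coeff_le:
  assumes "finite F"
  shows "(\<Sum>g\<in>F. cmod (cnj (coeff x g) * coeff y g)) \<le> norm x * norm y"
proof -
  have "(\<Sum>g\<in>F. cmod (cnj (coeff x g) * coeff y g))
      \<le> L2_set (\<lambda>g. cmod (coeff x g)) F * L2_set (\<lambda>g. cmod (coeff y g)) F"
    using L2_set_mult_ineq[of "\<lambda>g. cmod (coeff x g)" "\<lambda>g. cmod (coeff y g)" F]
    by (simp add: norm_mult)
  also have "\<dots> \<le> norm x * norm y"
    using assms by (intro mult_mono L2_set_coeff_le_norm) auto
  finally show ?thesis .
qed

lemma abs_summable_cinner: "(\<lambda>g. norm (cnj (coeff x g) * coeff y g)) summable_on UNIV"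
  by (rule nonneg_bdd_above_summable_on)
    (auto intro!: bdd_aboveI[of _ "norm x * norm y"] sum_cnj_mult_coeff_le)

lemma summable_cinner: "(\<lambda>g. cnj (coeff x g) * coeff y g) summable_on UNIV"
  by (rule abs_summable_summable[OF abs_summable_cinner])

lemma cmod_cinner_le: "cmod (cinner x y) \<le> norm x * norm y"
proof -
  have "cmod (cinner x y) \<le> (\<Sum>\<^sub>\<infinity>g. cmod (cnj (coeff x g) * coeff y g))"
    unfolding cinner_def by (rule norm_infsum_bound[OF abs_summable_cinner])
  also have "\<dots> \<le> norm x * norm y"
    by (rule infsum_le_finite_sums[OF abs_summable_cinner]) (rule sum_cnj_mult_coeff_le)
  finally show ?thesis .
qed

lemma cinner_add_right: "cinner x (y + z) = cinner x y + cinner x z"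
  unfolding cinner_def using infsum_add[OF summable_cinner[of x y] summable_cinner[of x z]]
  by (simp add: algebra_simps)

lemma cinner_add_left: "cinner (x + y) z = cinner x z + cinner y z"
  unfolding cinner_def using infsum_add[OF summable_cinner[of x z] summable_cinner[of y z]]
  by (simp add: algebra_simps)

lemma cinner_cscale_right: "cinner x (cscale c y) = c * cinner x y"
  unfolding cinner_def by (simp add: infsum_cmult_right'[symmetric] mult.left_commute)

lemma cinner_cscale_left: "cinner (cscale c x) y = cnj c * cinner x y"
  unfolding cinner_def by (simp add: infsum_cmult_right'[symmetric] mult.assoc)

lemma cinner_zero [simp]: "cinner 0 x = 0" "cinner x 0 = 0"
  by (simp_all add: cinner_def)

lemma cinner_diff_right: "cinner x (y - z) = cinner x y - cinner x z"
  using cinner_add_right[of x "y - z" z] by simp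

lemma cinner_diff_left: "cinner (x - y) z = cinner x z - cinner y z"
  using cinner_add_left[of "x - y" y z] by simp

lemma cinner_sum_right: "cinner x (sum f I) = (\<Sum>i\<in>I. cinner x (f i))"
  by (induction I rule: infinite_finite_induct) (auto simp: cinner_add_right)

lemma cinner_sum_left: "cinner (sum f I) x = (\<Sum>i\<in>I. cinner (f i) x)"
  by (induction I rule: infinite_finite_induct) (auto simp: cinner_add_left)

lemma cinner_commute: "cinner x y = cnj (cinner y x)"
proof -
  have "((\<lambda>g. cnj (coeff y g) * coeff x g) has_sum cinner y x) UNIV"
    unfolding cinner_def by (rule has_sum_infsum[OF summable_cinner])
  from has_sum_bounded_linear[OF bounded_linear_cnj this]
  show ?thesis
    unfolding cinner_def[of x y] by (simp add: o_def mult.commute infsumI)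
qed

lemma cinner_self: "cinner x x = of_real ((norm x)\<^sup>2)"
proof -
  have "((\<lambda>g. (cmod (coeff x g))\<^sup>2) has_sum (norm x)\<^sup>2) UNIV"
    using square_summable_coeff[of x] unfolding square_summable_def norm_ell2.rep_eq l2norm_def
    by (simp add: infsum_nonneg)
  from has_sum_bounded_linear[OF bounded_linear_of_real this]
  have "((\<lambda>g. complex_of_real ((cmod (coeff x g))\<^sup>2)) has_sum complex_of_real ((norm x)\<^sup>2)) UNIV"
    by (simp add: o_def)
  then have "((\<lambda>g. cnj (coeff x g) * coeff x g) has_sum complex_of_real ((norm x)\<^sup>2)) UNIV"
    by (simp only: complex_norm_square mult.commute)
  then show ?thesis
    unfolding cinner_def by (rule infsumI)
qed

lemma cinner_right_eqI:
  assumes "\<And>y. cinner x y = cinner x' y"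
  shows "x = x'"
proof -
  have "cinner (x - x') (x - x') = 0"
    by (simp add: cinner_diff_left assms)
  then show ?thesis by (simp add: cinner_self)
qed

lemma bounded_bilinear_cinner: "bounded_bilinear cinner"
proof
  show "\<exists>K. \<forall>a b. norm (cinner a b :: complex) \<le> norm a * norm b * K"
    using cmod_cinner_le by (intro exI[of _ 1]) auto
qed (simp_all add: cinner_add_left cinner_add_right cscale_of_real[symmetric] cinner_cscale_left
    cinner_cscale_right scaleR_conv_of_real del: of_real_eq_iff)

section \<open>Unit vectors and density of the finitely supported functions\<close>

definition delta :: "'g \<Rightarrow> 'g ell2" where
  "delta g = Abs_ell2 (\<lambda>h. if h = g then 1 else 0)"

lemma coeff_delta [simp]: "coeff (delta g) h = (if h = g then 1 else 0)"
  unfolding delta_def by (subst coeff_Abs_ell2) (auto intro: square_summable_finite)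

lemma cinner_delta: "cinner (delta g) x = coeff x g"
proof -
  have "cinner (delta g) x = (\<Sum>\<^sub>\<infinity>h\<in>{g}. cnj (coeff (delta g) h) * coeff x h)"
    unfolding cinner_def by (rule infsum_cong_neutral) auto
  then show ?thesis by simp
qed

lemma norm_delta [simp]: "norm (delta g) = 1"
proof -
  have "complex_of_real ((norm (delta g))\<^sup>2) = of_real 1"
    using cinner_self[of "delta g"] by (simp add: cinner_delta)
  then have "(norm (delta g))\<^sup>2 = 1"
    by (simp only: of_real_eq_iff)
  then show ?thesis
    using norm_ge_zero[of "delta g"] by (simp add: power2_eq_1_iff)
qed

lemma Cc_approx:
  assumes "e > 0"
  obtains y where "y \<in> Cc" "norm (x - y) < e"
proof -
  let ?f = "\<lambda>g. (cmod (coeff x g))\<^sup>2"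
  have sf: "?f summable_on UNIV"
    using square_summable_coeff[of x] by (simp add: square_summable_def)
  have e2: "(e / 2)\<^sup>2 > 0" using assms by simp
  obtain F where F: "finite F" "dist (sum ?f F) (infsum ?f UNIV) \<le> (e / 2)\<^sup>2"
    using infsum_finite_approximation[OF sf e2] by blast
  define y where "y = Abs_ell2 (\<lambda>g. if g \<in> F then coeff x g else 0)"
  have cy: "coeff y = (\<lambda>g. if g \<in> F then coeff x g else 0)"
    unfolding y_def using F by (intro coeff_Abs_ell2 square_summable_finite) auto
  have "norm (x - y) \<le> e / 2"
  proof (rule norm_ell2_leI)
    fix G :: "'a set" assume G: "finite G"
    have "(\<Sum>g\<in>G. (cmod (coeff (x - y) g))\<^sup>2) = sum ?f (G - F)"
      using G by (intro sum.mono_neutral_cong_right) (auto simp: cy)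
    also have "\<dots> = sum ?f (G \<union> F) - sum ?f F"
      using G F sum.union_disjoint[of "G - F" F ?f]
      by (auto simp: Un_commute[of F G] Int_commute Diff_disjoint)
    also have "\<dots> \<le> infsum ?f UNIV - sum ?f F"
      using G F sf by (auto intro!: finite_sum_le_infsum)
    also have "\<dots> \<le> (e / 2)\<^sup>2"
      using F by (simp add: dist_real_def)
    finally have "L2_set (\<lambda>g. cmod (coeff (x - y) g)) G \<le> sqrt ((e / 2)\<^sup>2)"
      unfolding L2_set_def by (rule real_sqrt_le_mono)
    then show "L2_set (\<lambda>g. cmod (coeff (x - y) g)) G \<le> e / 2"
      using assms by simp
  qed
  moreover have "y \<in> Cc"
    unfolding Cc_def using F by (auto simp: cy)
  ultimately show ?thesis
    using that assms by force
qed

lemma closure_Cc: "closure Cc = (UNIV :: 'g ell2 set)"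
proof -
  have "x \<in> closure Cc" for x :: "'g ell2"
    unfolding closure_approachable dist_norm
    using Cc_approx[of _ x] by (metis norm_minus_commute)
  then show ?thesis by blast
qed

text \<open>Continuous maps that agree on a dense set are equal. This gives the uniqueness that the
  definite description in \<open>length_commutator\<close> asks for.\<close>

lemma blinfun_eq_on_Cc:
  fixes R T :: "'g ell2 \<Rightarrow>\<^sub>L 'g ell2"
  assumes "\<And>x. x \<in> Cc \<Longrightarrow> blinfun_apply R x = blinfun_apply T x"
  shows "R = T"
proof (rule blinfun_eqI)
  fix x
  have "closed {x. blinfun_apply R x = blinfun_apply T x}"
    by (intro closed_Collect_eq) (auto intro!: continuous_intros)
  then have "closure Cc \<subseteq> {x. blinfun_apply R x = blinfun_apply T x}"
    using assms by (intro closure_minimal) auto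
  then show "blinfun_apply R x = blinfun_apply T x"
    by (auto simp: closure_Cc)
qed

text \<open>Completeness here makes the space of bounded operators complete, so that a closed set of
  operators, such as the carrier of the reduced algebra, is complete as well.\<close>

instance ell2 :: (type) banach
proof
  fix X :: "nat \<Rightarrow> 'a ell2"
  assume X: "Cauchy X"
  have "Cauchy (\<lambda>n. coeff (X n) g)" for g
  proof (rule CauchyI)
    fix e :: real assume "e > 0"
    then obtain M where "\<forall>m\<ge>M. \<forall>n\<ge>M. norm (X m - X n) < e"
      using CauchyD[OF X] by blast
    moreover have "norm (coeff (X m) g - coeff (X n) g) \<le> norm (X m - X n)" for m n
      using cmod_coeff_le_norm[of "X m - X n" g] by simp
    ultimately show "\<exists>M. \<forall>m\<ge>M. \<forall>n\<ge>M. norm (coeff (X m) g - coeff (X n) g) < e"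
      by (meson order.strict_trans1)
  qed
  then have "\<forall>g. \<exists>a. (\<lambda>n. coeff (X n) g) \<longlonglongrightarrow> a"
    using Cauchy_convergent convergent_def by blast
  then obtain y where y: "\<And>g. (\<lambda>n. coeff (X n) g) \<longlonglongrightarrow> y g"
    by metis
  \<comment> \<open>Only finitely many coordinates enter, so coordinatewise convergence suffices to
    let the second index of the Cauchy estimate tend to infinity.\<close>
  have bound: "L2_set (\<lambda>g. cmod (coeff (X n) g - y g)) F \<le> e"
    if M: "\<forall>m\<ge>M. \<forall>n\<ge>M. norm (X m - X n) < e" and n: "n \<ge> M" and F: "finite F" for M n e F
  proof (rule LIMSEQ_le_const2)
    show "(\<lambda>m. L2_set (\<lambda>g. cmod (coeff (X n) g - coeff (X m) g)) F)
        \<longlonglongrightarrow> L2_set (\<lambda>g. cmod (coeff (X n) g - y g)) F"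
      unfolding L2_set_def by (intro tendsto_intros y)
    show "\<exists>N. \<forall>m\<ge>N. L2_set (\<lambda>g. cmod (coeff (X n) g - coeff (X m) g)) F \<le> e"
    proof (intro exI[of _ M] allI impI)
      fix m assume "M \<le> m"
      then have "norm (X n - X m) \<le> e" using M n by (simp add: less_imp_le)
      with L2_set_coeff_le_norm[OF F, of "X n - X m"]
      show "L2_set (\<lambda>g. cmod (coeff (X n) g - coeff (X m) g)) F \<le> e" by simp
    qed
  qed
  obtain M0 where M0: "\<forall>m\<ge>M0. \<forall>n\<ge>M0. norm (X m - X n) < 1"
    using CauchyD[OF X zero_less_one] by blast
  have "square_summable (\<lambda>g. coeff (X M0) g - y g)"
    using bound[OF M0 order.refl] by (rule square_summable_l2normI)
  from square_summable_add(1)[OF square_summable_coeff[of "X M0"] square_summable_cmult[OF this, of "-1"]]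
  have sy: "square_summable y" by simp
  have "X \<longlonglongrightarrow> Abs_ell2 y"
  proof (rule LIMSEQ_I)
    fix e :: real assume e: "e > 0"
    then obtain M where M: "\<forall>m\<ge>M. \<forall>n\<ge>M. norm (X m - X n) < e / 2"
      using CauchyD[OF X, of "e / 2"] by auto
    have "norm (X n - Abs_ell2 y) < e" if "n \<ge> M" for n
    proof -
      have "norm (X n - Abs_ell2 y) \<le> e / 2"
        using bound[OF M that] by (intro norm_ell2_leI) (simp add: coeff_Abs_ell2 sy)
      then show ?thesis using e by linarith
    qed
    then show "\<exists>no. \<forall>n\<ge>no. norm (X n - Abs_ell2 y) < e"
      by blast
  qed
  then show "convergent X" by (auto simp: convergent_def)
qed

section \<open>Linear combinations of twisted translations\<close>

lemma cscale_op_simps [simp]: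
  "cscale_op 0 T = 0" "cscale_op 1 T = T" "cscale_op c 0 = 0"
  "cscale_op c (cscale_op d T) = cscale_op (c * d) T"
  by (auto intro!: blinfun_eqI)

lemma cscale_op_of_real: "cscale_op (of_real t) T = t *\<^sub>R T"
  by (auto intro!: blinfun_eqI simp: cscale_of_real blinfun.scaleR_left)

lemma cscale_op_add_left: "cscale_op (c + d) T = cscale_op c T + cscale_op d T"
  by (auto intro!: blinfun_eqI simp: cscale_add_left blinfun.add_left)

lemma cscale_op_add_right: "cscale_op c (T + R) = cscale_op c T + cscale_op c R"
  by (auto intro!: blinfun_eqI simp: cscale_add_right blinfun.add_left)

lemma cscale_op_sum_right: "cscale_op c (sum f I) = (\<Sum>i\<in>I. cscale_op c (f i))"
  by (induction I rule: infinite_finite_induct) (auto simp: cscale_op_add_right)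

lemma norm_cscale_op: "norm (cscale_op c T) = cmod c * norm T"
proof -
  have le: "norm (cscale_op d R) \<le> cmod d * norm R" for d and R :: "'a ell2 \<Rightarrow>\<^sub>L 'a ell2"
  proof (rule norm_blinfun_bound)
    fix x
    show "norm (blinfun_apply (cscale_op d R) x) \<le> cmod d * norm R * norm x"
      using mult_left_mono[OF norm_blinfun[of R x], of "cmod d"]
      by (simp add: norm_cscale mult.assoc)
  qed simp
  show ?thesis
  proof (cases "c = 0")
    case False
    have "norm T = norm (cscale_op (inverse c) (cscale_op c T))"
      using False by simp
    also have "\<dots> \<le> cmod (inverse c) * norm (cscale_op c T)"
      by (rule le)
    finally have "cmod c * norm T \<le> norm (cscale_op c T)"
      using False by (simp add: norm_inverse norm_divide field_simps)
    with le[of c T] show ?thesis by simp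
  qed simp
qed

text \<open>The translations in \<open>lreg\<close> are replaced by an arbitrary family V, so that
  the representation and all its iterated commutators share one linear algebra.\<close>

definition lincomb :: "('g \<Rightarrow> 'g ell2 \<Rightarrow>\<^sub>L 'g ell2) \<Rightarrow> 'g ell2 \<Rightarrow> ('g ell2 \<Rightarrow>\<^sub>L 'g ell2)" where
  "lincomb V f = (\<Sum>g | coeff f g \<noteq> 0. cscale_op (coeff f g) (V g))"

lemma lreg_eq_lincomb: "lreg = lincomb unitary_translation"
  by (simp add: fun_eq_iff lreg_def lincomb_def)

lemma lincomb_superset:
  assumes "finite F" "{g. coeff f g \<noteq> 0} \<subseteq> F"
  shows "lincomb V f = (\<Sum>g\<in>F. cscale_op (coeff f g) (V g))"
  unfolding lincomb_def using assms by (intro sum.mono_neutral_left) auto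

lemma Cc_cscale: "f \<in> Cc \<Longrightarrow> cscale c f \<in> Cc"
  unfolding Cc_def by (auto elim: rev_finite_subset)

lemma Cc_add:
  assumes "f \<in> Cc" "f' \<in> Cc"
  shows "f + f' \<in> Cc"
  unfolding Cc_def
  by (clarify, rule finite_subset[of _ "{g. coeff f g \<noteq> 0} \<union> {g. coeff f' g \<noteq> 0}"])
    (use assms in \<open>auto simp: Cc_def\<close>)

lemma Cc_zero: "0 \<in> Cc"
  by (simp add: Cc_def)

lemma delta_in_Cc: "delta g \<in> Cc"
  by (simp add: Cc_def)

lemma lincomb_delta: "lincomb V (delta g) = V g"
  by (subst lincomb_superset[where F = "{g}"]) auto

lemma lincomb_add:
  assumes "f \<in> Cc" "f' \<in> Cc"
  shows "lincomb V (f + f') = lincomb V f + lincomb V f'"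
proof -
  let ?F = "{g. coeff f g \<noteq> 0} \<union> {g. coeff f' g \<noteq> 0}"
  have F: "finite ?F" using assms by (simp add: Cc_def)
  have *: "lincomb V h = (\<Sum>g\<in>?F. cscale_op (coeff h g) (V g))"
    if "{g. coeff h g \<noteq> 0} \<subseteq> ?F" for h
    using F that by (rule lincomb_superset)
  have "{g. coeff (f + f') g \<noteq> 0} \<subseteq> ?F" by auto
  from *[OF this] show ?thesis
    unfolding *[OF Un_upper1] *[OF Un_upper2] by (simp only: coeff_simps cscale_op_add_left sum.distrib)
qed

lemma lincomb_cscale:
  assumes "f \<in> Cc"
  shows "lincomb V (cscale c f) = cscale_op c (lincomb V f)"
proof -
  have "lincomb V (cscale c f) = (\<Sum>g | coeff f g \<noteq> 0. cscale_op (coeff (cscale c f) g) (V g))"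
    using assms by (intro lincomb_superset) (auto simp: Cc_def)
  then show ?thesis
    by (simp add: lincomb_def cscale_op_sum_right)
qed

lemma coeff_lincomb:
  "coeff (blinfun_apply (lincomb V f) x) h
     = (\<Sum>g | coeff f g \<noteq> 0. coeff f g * coeff (blinfun_apply (V g) x) h)"
  by (simp add: lincomb_def blinfun.sum_left coeff_sum)

lemma norm_unitary_translation: "norm (unitary_translation g) = 1"
proof (rule antisym)
  show "norm (unitary_translation g) \<le> 1"
    by (rule norm_blinfun_bound) (auto simp: norm_translation)
  show "1 \<le> norm (unitary_translation g)"
    using norm_blinfun[of "unitary_translation g" "delta 0"] by (simp add: norm_translation)
qed

lemma l2norm_mult_bounded:
  fixes m :: "'g \<Rightarrow> real"
  assumes m: "\<And>h. \<bar>m h\<bar> \<le> B" and x: "square_summable x"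
  shows "square_summable (\<lambda>h. of_real (m h) * x h)" "l2norm (\<lambda>h. of_real (m h) * x h) \<le> B * l2norm x"
proof -
  have B: "0 \<le> B" using m[of undefined] by linarith
  have "L2_set (\<lambda>h. cmod (of_real (m h) * x h)) F \<le> B * l2norm x" if "finite F" for F
  proof -
    have "L2_set (\<lambda>h. cmod (of_real (m h) * x h)) F \<le> L2_set (\<lambda>h. B * cmod (x h)) F"
      using m by (intro L2_set_mono) (auto simp: norm_mult intro: mult_right_mono)
    also have "\<dots> = B * L2_set (\<lambda>h. cmod (x h)) F"
      using B by (simp add: L2_set_right_distrib)
    also have "\<dots> \<le> B * l2norm x"
      using B L2_set_le_l2norm[OF x that] by (rule mult_left_mono[rotated])
    finally show ?thesis .
  qed
  from square_summable_l2normI[of "\<lambda>h. of_real (m h) * x h", OF this]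
  show "square_summable (\<lambda>h. of_real (m h) * x h)" "l2norm (\<lambda>h. of_real (m h) * x h) \<le> B * l2norm x"
    by blast+
qed

section \<open>Length functions and iterated commutators\<close>

locale length_function =
  fixes l :: "'g::group_add \<Rightarrow> real"
  assumes l_zero: "l 0 = 0"
    and l_ge_1: "g \<noteq> 0 \<Longrightarrow> 1 \<le> l g"
    and l_uminus: "l (- g) = l g"
    and l_add_le: "l (g + h) \<le> l g + l h"
begin

lemma l_nonneg: "0 \<le> l g"
  using l_zero l_ge_1[of g] by (cases "g = 0") auto

text \<open>Subadditivity for h = g + (- g + h) gives one sign, subadditivity for - g + h the other.
  This is why commutators with the unbounded multiplication operator are bounded.\<close>

lemma abs_l_diff_le: "\<bar>l h - l (- g + h)\<bar> \<le> l g"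
  using l_add_le[of g "- g + h"] l_add_le[of "- g" h] by (simp add: add.assoc[symmetric] l_uminus)

lemma abs_l_diff_power_le: "\<bar>(l h - l (- g + h)) ^ j\<bar> \<le> l g ^ j"
  by (simp add: power_abs abs_l_diff_le power_mono)

text \<open>The \<open>j\<close>-fold commutator of the length multiplication operator with the translation by \<open>g\<close>.\<close>

definition twist :: "nat \<Rightarrow> 'g \<Rightarrow> ('g ell2 \<Rightarrow>\<^sub>L 'g ell2)" where
  "twist j g =
     Blinfun (\<lambda>x. Abs_ell2 (\<lambda>h. of_real ((l h - l (- g + h)) ^ j) * coeff (translation g x) h))"

lemma
  shows coeff_twist [simp]:
      "coeff (blinfun_apply (twist j g) x) h = of_real ((l h - l (- g + h)) ^ j) * coeff x (- g + h)"
    and norm_twist_le: "norm (twist j g) \<le> l g ^ j"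
proof -
  let ?w = "\<lambda>x h. of_real ((l h - l (- g + h)) ^ j) * coeff (translation g x) h"
  \<comment> \<open>\<open>Abs_ell2\<close> and \<open>Blinfun\<close> carry meaning only on
    square-summable functions and bounded linear maps, so both properties come before unfolding the
    definition.\<close>
  have *: "square_summable (?w x)" "l2norm (?w x) \<le> l g ^ j * l2norm (coeff (translation g x))" for x
    by (rule l2norm_mult_bounded[OF abs_l_diff_power_le[of _ g j] square_summable_coeff])+
  have c: "coeff (Abs_ell2 (?w x)) = ?w x" for x
    by (rule coeff_Abs_ell2) (rule *)
  have n: "norm (Abs_ell2 (?w x)) \<le> l g ^ j * norm x" for x
    using *(2)[of x] by (simp only: norm_ell2.rep_eq[symmetric, of "translation g x"] norm_translation
        norm_ell2.rep_eq[of "Abs_ell2 (?w x)"] c)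
  have bl: "bounded_linear (\<lambda>x. Abs_ell2 (?w x))"
  proof (rule bounded_linear_intro)
    show "norm (Abs_ell2 (?w x)) \<le> norm x * l g ^ j" for x
      using n[of x] by (simp add: mult.commute)
  qed (rule ell2_eqI, simp only: c coeff_simps, simp add: algebra_simps)+
  then show "coeff (blinfun_apply (twist j g) x) h = of_real ((l h - l (- g + h)) ^ j) * coeff x (- g + h)"
    unfolding twist_def bounded_linear_Blinfun_apply[OF bl] c by simp
  show "norm (twist j g) \<le> l g ^ j"
    unfolding twist_def using bl n
    by (intro norm_blinfun_bound) (auto simp: bounded_linear_Blinfun_apply l_nonneg)
qed

lemma twist_0: "twist 0 = unitary_translation"
  by (auto intro!: ext blinfun_eqI ell2_eqI)

text \<open>The support lies in the product of the two supports. Finite support of the image matters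
  because \<open>mult_length\<close> is multiplication by l only on \<open>Cc\<close> and takes the
  value 0 elsewhere.\<close>

lemma lincomb_twist_in_Cc:
  assumes "f \<in> Cc" "x \<in> Cc"
  shows "blinfun_apply (lincomb (twist j) f) x \<in> Cc"
proof -
  let ?F = "(\<lambda>(g, h). g + h) ` ({g. coeff f g \<noteq> 0} \<times> {h. coeff x h \<noteq> 0})"
  have "h \<in> ?F" if "coeff (blinfun_apply (lincomb (twist j) f) x) h \<noteq> 0" for h
  proof -
    from that obtain g where "coeff f g \<noteq> 0" "coeff x (- g + h) \<noteq> 0"
      unfolding coeff_lincomb by (elim sum.not_neutral_contains_not_neutral) auto
    then show ?thesis
      by (intro image_eqI[of _ _ "(g, - g + h)"]) (auto simp: add.assoc[symmetric])
  qed
  moreover have "finite ?F" using assms by (simp add: Cc_def)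
  ultimately show ?thesis
    unfolding Cc_def by (auto elim: rev_finite_subset)
qed

lemma coeff_mult_length: "x \<in> Cc \<Longrightarrow> coeff (mult_length l x) h = of_real (l h) * coeff x h"
  by (simp add: mult_length.rep_eq Cc_def)

text \<open>The matrix entry at row h and column - g + h is multiplied by \<open>l h\<close> from
  the left and by \<open>l (- g + h)\<close> from the right; the difference raises the exponent of
  the weight by one.\<close>

lemma length_commutator_lincomb_twist:
  assumes f: "f \<in> Cc"
  shows "length_commutator l (lincomb (twist j) f) = lincomb (twist (Suc j)) f"
  unfolding length_commutator_def
proof (rule the_equality)
  show *: "\<forall>x\<in>Cc. blinfun_apply (lincomb (twist (Suc j)) f) x
      = mult_length l (blinfun_apply (lincomb (twist j) f) x)
        - blinfun_apply (lincomb (twist j) f) (mult_length l x)"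
  proof (intro ballI ell2_eqI)
    fix x h assume x: "x \<in> (Cc :: 'g ell2 set)"
    have "coeff (mult_length l (blinfun_apply (lincomb (twist j) f) x)
        - blinfun_apply (lincomb (twist j) f) (mult_length l x)) h
      = (\<Sum>g | coeff f g \<noteq> 0. of_real (l h) * (coeff f g * (of_real ((l h - l (- g + h)) ^ j) * coeff x (- g + h)))
          - coeff f g * (of_real ((l h - l (- g + h)) ^ j) * (of_real (l (- g + h)) * coeff x (- g + h))))"
      by (simp only: coeff_simps coeff_mult_length[OF x] coeff_mult_length[OF lincomb_twist_in_Cc[OF f x]]
          coeff_lincomb coeff_twist sum_distrib_left sum_subtractf)
    also have "\<dots> = coeff (blinfun_apply (lincomb (twist (Suc j)) f) x) h"
      unfolding coeff_lincomb coeff_twist by (intro sum.cong refl) (simp add: algebra_simps)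
    finally show "coeff (blinfun_apply (lincomb (twist (Suc j)) f) x) h
      = coeff (mult_length l (blinfun_apply (lincomb (twist j) f) x)
        - blinfun_apply (lincomb (twist j) f) (mult_length l x)) h" by simp
  qed
  fix R
  assume "\<forall>x\<in>Cc. blinfun_apply R x = mult_length l (blinfun_apply (lincomb (twist j) f) x)
        - blinfun_apply (lincomb (twist j) f) (mult_length l x)"
  then show "R = lincomb (twist (Suc j)) f"
    using * by (intro blinfun_eq_on_Cc) auto
qed

lemma length_commutator_power:
  "f \<in> Cc \<Longrightarrow> (length_commutator l ^^ j) (lreg f) = lincomb (twist j) f"
  by (induction j) (simp_all add: length_commutator_lincomb_twist lreg_eq_lincomb twist_0)

lemma length_seminorm_lreg:
  "f \<in> Cc \<Longrightarrow> length_seminorm l k (lreg f) = ennreal (norm (lincomb (twist k) f))"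
  by (simp add: length_seminorm_def length_commutator_power)

lemma coeff_lincomb_twist_delta:
  assumes "f \<in> Cc"
  shows "coeff (blinfun_apply (lincomb (twist j) f) (delta 0)) h = of_real (l h ^ j) * coeff f h"
proof -
  \<comment> \<open>The vector \<open>delta 0\<close> is nonzero only where - g + h = 0, so the term
    g = h alone survives, and there the weight is \<open>(l h - l 0) ^ j\<close>.\<close>
  have "coeff (blinfun_apply (lincomb (twist j) f) (delta 0)) h
      = (\<Sum>g | coeff f g \<noteq> 0. if g = h then of_real (l h ^ j) * coeff f h else 0)"
    unfolding coeff_lincomb
    by (intro sum.cong) (auto simp: l_zero neg_eq_iff_add_eq_0 add_eq_0_iff)
  also have "\<dots> = of_real (l h ^ j) * coeff f h"
    using assms by (auto simp: Cc_def)
  finally show ?thesis .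
qed

lemma L2_set_le_norm_lincomb_twist:
  assumes "f \<in> Cc" "finite F"
  shows "L2_set (\<lambda>g. l g ^ j * cmod (coeff f g)) F \<le> norm (lincomb (twist j) f)"
proof -
  have "L2_set (\<lambda>g. l g ^ j * cmod (coeff f g)) F
      \<le> norm (blinfun_apply (lincomb (twist j) f) (delta 0))"
    using L2_set_coeff_le_norm[OF assms(2), of "blinfun_apply (lincomb (twist j) f) (delta 0)"]
    by (simp add: coeff_lincomb_twist_delta[OF assms(1)] norm_mult norm_power l_nonneg)
  also have "\<dots> \<le> norm (lincomb (twist j) f)"
    using norm_blinfun[of "lincomb (twist j) f" "delta 0"] by simp
  finally show ?thesis .
qed

end

text \<open>For \<open>j = 0\<close> the operators \<open>twist j g\<close> do not depend on the length function, so facts about \<open>lreg\<close>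
  are obtained from the trivial one.\<close>

lemma lreg_apply_delta:
  assumes "f \<in> Cc"
  shows "blinfun_apply (lreg f) (delta 0) = f"
proof -
  interpret length_function "\<lambda>g::'a. if g = 0 then 0 else 1 :: real"
    by unfold_locales auto
  show ?thesis
    using coeff_lincomb_twist_delta[OF assms, of 0]
    by (intro ell2_eqI) (simp add: lreg_eq_lincomb twist_0)
qed

section \<open>The reduced group C*-algebra\<close>

definition is_adjoint :: "('g ell2 \<Rightarrow>\<^sub>L 'g ell2) \<Rightarrow> ('g ell2 \<Rightarrow>\<^sub>L 'g ell2) \<Rightarrow> bool" where
  "is_adjoint T R \<longleftrightarrow> (\<forall>x y. cinner (blinfun_apply R x) y = cinner x (blinfun_apply T y))"

lemma is_adjointD: "is_adjoint T R \<Longrightarrow> cinner (blinfun_apply R x) y = cinner x (blinfun_apply T y)"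
  by (simp add: is_adjoint_def)

text \<open>Nondegeneracy of the inner product gives uniqueness, so exhibiting any adjoint evaluates
  the definite description.\<close>

lemma adjoint_op_eqI:
  assumes "is_adjoint T R"
  shows "adjoint_op T = R"
  unfolding adjoint_op_def
proof (rule the_equality)
  show "\<forall>x y. cinner (blinfun_apply R x) y = cinner x (blinfun_apply T y)"
    using assms by (simp add: is_adjoint_def)
  then show "R' = R" if "\<forall>x y. cinner (blinfun_apply R' x) y = cinner x (blinfun_apply T y)" for R'
    using that by (intro blinfun_eqI cinner_right_eqI) simp
qed

lemma is_adjoint_sym:
  assumes "is_adjoint T R"
  shows "is_adjoint R T"
  unfolding is_adjoint_def
proof (intro allI)
  fix x y
  show "cinner (blinfun_apply T x) y = cinner x (blinfun_apply R y)"
    using is_adjointD[OF assms, of y x] cinner_commute[of "blinfun_apply T x" y]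
      cinner_commute[of x "blinfun_apply R y"] by simp
qed

lemma is_adjoint_norm_le:
  assumes "is_adjoint T R"
  shows "norm R \<le> norm T"
proof (rule norm_blinfun_bound)
  fix x
  let ?y = "blinfun_apply R x"
  have "(norm ?y)\<^sup>2 = cmod (cinner ?y ?y)"
    by (simp add: cinner_self norm_power)
  also have "\<dots> = cmod (cinner x (blinfun_apply T ?y))"
    by (simp add: is_adjointD[OF assms])
  also have "\<dots> \<le> norm x * norm (blinfun_apply T ?y)"
    by (rule cmod_cinner_le)
  also have "\<dots> \<le> norm x * (norm T * norm ?y)"
    by (intro mult_left_mono norm_blinfun) auto
  finally have "norm ?y * norm ?y \<le> (norm T * norm x) * norm ?y"
    by (simp add: power2_eq_square mult_ac)
  then show "norm ?y \<le> norm T * norm x"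
    by (cases "norm ?y = 0") (auto simp: mult_le_cancel_right)
qed simp

lemma is_adjoint_norm_eq: "is_adjoint T R \<Longrightarrow> norm R = norm T"
  by (meson antisym is_adjoint_norm_le is_adjoint_sym)

lemma is_adjoint_norm_compose:
  assumes "is_adjoint T R"
  shows "norm (R o\<^sub>L T) = (norm T)\<^sup>2"
proof (rule antisym)
  show "norm (R o\<^sub>L T) \<le> (norm T)\<^sup>2"
    using norm_blinfun_compose[of R T] by (simp add: is_adjoint_norm_eq[OF assms] power2_eq_square)
  have "norm T \<le> sqrt (norm (R o\<^sub>L T))"
  proof (rule norm_blinfun_bound)
    fix x
    have "(norm (blinfun_apply T x))\<^sup>2 = cmod (cinner (blinfun_apply T x) (blinfun_apply T x))"
      by (simp add: cinner_self norm_power)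
    also have "\<dots> = cmod (cinner (blinfun_apply (R o\<^sub>L T) x) x)"
      by (simp add: is_adjointD[OF assms])
    also have "\<dots> \<le> norm (blinfun_apply (R o\<^sub>L T) x) * norm x"
      by (rule cmod_cinner_le)
    also have "\<dots> \<le> (norm (R o\<^sub>L T) * norm x) * norm x"
      by (intro mult_right_mono norm_blinfun) auto
    finally have "(norm (blinfun_apply T x))\<^sup>2 \<le> norm (R o\<^sub>L T) * (norm x)\<^sup>2"
      by (simp add: power2_eq_square mult.assoc)
    then have "norm (blinfun_apply T x) \<le> sqrt (norm (R o\<^sub>L T) * (norm x)\<^sup>2)"
      by (rule real_le_rsqrt)
    then show "norm (blinfun_apply T x) \<le> sqrt (norm (R o\<^sub>L T)) * norm x"
      by (simp add: real_sqrt_mult)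
  qed simp
  then have "(norm T)\<^sup>2 \<le> (sqrt (norm (R o\<^sub>L T)))\<^sup>2"
    by (rule power_mono) simp
  then show "(norm T)\<^sup>2 \<le> norm (R o\<^sub>L T)" by simp
qed

lemma is_adjoint_add: "is_adjoint T R \<Longrightarrow> is_adjoint T' R' \<Longrightarrow> is_adjoint (T + T') (R + R')"
  by (simp add: is_adjoint_def blinfun.add_left cinner_add_left cinner_add_right)

lemma is_adjoint_diff: "is_adjoint T R \<Longrightarrow> is_adjoint T' R' \<Longrightarrow> is_adjoint (T - T') (R - R')"
  by (simp add: is_adjoint_def blinfun.diff_left cinner_diff_left cinner_diff_right)

lemma is_adjoint_cscale_op: "is_adjoint T R \<Longrightarrow> is_adjoint (cscale_op c T) (cscale_op (cnj c) R)"
  by (simp add: is_adjoint_def cinner_cscale_left cinner_cscale_right)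

lemma is_adjoint_sum:
  "(\<And>i. i \<in> I \<Longrightarrow> is_adjoint (T i) (R i)) \<Longrightarrow> is_adjoint (sum T I) (sum R I)"
  by (simp add: is_adjoint_def blinfun.sum_left cinner_sum_left cinner_sum_right)

lemma is_adjoint_compose: "is_adjoint T R \<Longrightarrow> is_adjoint T' R' \<Longrightarrow> is_adjoint (T o\<^sub>L T') (R' o\<^sub>L R)"
  by (simp add: is_adjoint_def)

text \<open>Taking adjoints is isometric and compatible with differences, so the adjoints of a
  convergent sequence are Cauchy. This yields adjoints on the closure from the explicit ones on the
  group algebra.\<close>

lemma is_adjoint_limit:
  assumes "\<And>n. is_adjoint (T n) (R n)" "T \<longlonglongrightarrow> T'"
  obtains R' where "R \<longlonglongrightarrow> R'" "is_adjoint T' R'"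
proof -
  have eq: "norm (R m - R n) = norm (T m - T n)" for m n
    by (intro is_adjoint_norm_eq is_adjoint_diff assms)
  have "Cauchy T" using assms(2) by (rule LIMSEQ_imp_Cauchy)
  then have "Cauchy R" by (simp add: Cauchy_iff eq)
  then obtain R' where R': "R \<longlonglongrightarrow> R'"
    using Cauchy_convergent convergent_def by blast
  have "is_adjoint T' R'"
    unfolding is_adjoint_def
  proof (intro allI)
    fix x y
    have "(\<lambda>n. cinner (blinfun_apply (R n) x) y) \<longlonglongrightarrow> cinner (blinfun_apply R' x) y"
      by (intro bounded_bilinear.tendsto[OF bounded_bilinear_cinner] tendsto_intros R')
    moreover have "(\<lambda>n. cinner x (blinfun_apply (T n) y)) \<longlonglongrightarrow> cinner x (blinfun_apply T' y)"
      by (intro bounded_bilinear.tendsto[OF bounded_bilinear_cinner] tendsto_intros assms(2))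
    ultimately show "cinner (blinfun_apply R' x) y = cinner x (blinfun_apply T' y)"
      unfolding is_adjointD[OF assms(1)] by (rule LIMSEQ_unique)
  qed
  with R' show ?thesis by (rule that)
qed

definition involution :: "'g::group_add ell2 \<Rightarrow> 'g ell2" where
  "involution f = Abs_ell2 (\<lambda>g. cnj (coeff f (- g)))"

lemma
  assumes "f \<in> Cc"
  shows coeff_involution: "coeff (involution f) g = cnj (coeff f (- g))"
    and support_involution: "{g. coeff (involution f) g \<noteq> 0} = uminus ` {g. coeff f g \<noteq> 0}"
    and involution_in_Cc: "involution f \<in> Cc"
proof -
  have eq: "{g. coeff f (- g) \<noteq> 0} = uminus ` {g. coeff f g \<noteq> 0}"
    by (auto intro: image_eqI[of _ uminus "- _"])
  then have fin: "finite {g. coeff f (- g) \<noteq> 0}"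
    using assms by (simp add: Cc_def)
  have c: "coeff (involution f) = (\<lambda>g. cnj (coeff f (- g)))"
    unfolding involution_def using fin by (intro coeff_Abs_ell2 square_summable_finite) simp
  show "coeff (involution f) g = cnj (coeff f (- g))"
    "{g. coeff (involution f) g \<noteq> 0} = uminus ` {g. coeff f g \<noteq> 0}" "involution f \<in> Cc"
    using fin eq by (simp_all add: c Cc_def)
qed

text \<open>Two families are needed because adjoints of twisted translations acquire a sign.\<close>

lemma is_adjoint_lincomb:
  assumes "f \<in> Cc" "\<And>g. is_adjoint (V g) (W (- g))"
  shows "is_adjoint (lincomb V f) (lincomb W (involution f))"
proof -
  have "lincomb W (involution f) = (\<Sum>g | coeff f g \<noteq> 0. cscale_op (cnj (coeff f g)) (W (- g)))"
    unfolding lincomb_def support_involution[OF assms(1)]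
    by (subst sum.reindex) (auto simp: coeff_involution[OF assms(1)])
  then show ?thesis
    by (simp add: lincomb_def is_adjoint_sum is_adjoint_cscale_op assms(2))
qed

context length_function
begin

text \<open>With M the self-adjoint multiplication by l, the adjoint of [M, T] is the negative of
  the commutator of M with the adjoint of T; hence one sign per commutator.\<close>

lemma is_adjoint_twist: "is_adjoint (twist j g) ((-1) ^ j *\<^sub>R twist j (- g))"
  unfolding is_adjoint_def
proof (intro allI)
  fix x y
  have bij: "bij (\<lambda>h. g + h)"
    by (rule o_bij[of "\<lambda>h. - g + h"]) (auto simp: fun_eq_iff add.assoc[symmetric])
  have "cinner x (blinfun_apply (twist j g) y)
      = (\<Sum>\<^sub>\<infinity>h. cnj (coeff x (g + h)) * coeff (blinfun_apply (twist j g) y) (g + h))"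
    unfolding cinner_def using infsum_reindex_bij_betw[OF bij] by (rule sym)
  also have "\<dots> = (\<Sum>\<^sub>\<infinity>h. cnj (coeff (blinfun_apply ((-1) ^ j *\<^sub>R twist j (- g)) x) h) * coeff y h)"
  proof (rule infsum_cong)
    fix h
    have "(of_real (l h) - of_real (l (g + h))) ^ j
        = (-1) ^ j * (of_real (l (g + h)) - of_real (l h) :: complex) ^ j"
      by (simp add: power_mult_distrib[symmetric])
    then show "cnj (coeff x (g + h)) * coeff (blinfun_apply (twist j g) y) (g + h)
        = cnj (coeff (blinfun_apply ((-1) ^ j *\<^sub>R twist j (- g)) x) h) * coeff y h"
      by (simp add: blinfun.scaleR_left add.assoc[symmetric] power_mult_distrib[symmetric])
  qed
  finally show "cinner (blinfun_apply ((-1) ^ j *\<^sub>R twist j (- g)) x) y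
      = cinner x (blinfun_apply (twist j g) y)"
    by (simp add: cinner_def)
qed

text \<open>The sign has modulus one and disappears in the norm, which makes L^k invariant under the
  involution.\<close>

lemma norm_lincomb_twist_involution:
  assumes "f \<in> Cc"
  shows "norm (lincomb (twist j) (involution f)) = norm (lincomb (twist j) f)"
proof -
  have "is_adjoint (lincomb (twist j) f) (lincomb (\<lambda>g. (-1) ^ j *\<^sub>R twist j g) (involution f))"
    using assms is_adjoint_twist by (rule is_adjoint_lincomb)
  moreover have "lincomb (\<lambda>g. (-1) ^ j *\<^sub>R twist j g) (involution f) = (-1) ^ j *\<^sub>R lincomb (twist j) (involution f)"
    unfolding lincomb_def scaleR_sum_right
    by (simp add: cscale_op_of_real[symmetric] mult.commute del: of_real_power)
  ultimately have "norm ((-1) ^ j *\<^sub>R lincomb (twist j) (involution f)) = norm (lincomb (twist j) f)"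
    using is_adjoint_norm_eq by metis
  then show ?thesis by (simp add: power_abs)
qed

end

lemma is_adjoint_unitary_translation: "is_adjoint (unitary_translation g) (unitary_translation (- g))"
proof -
  interpret length_function "\<lambda>g::'a. if g = 0 then 0 else 1 :: real"
    by unfold_locales auto
  show ?thesis using is_adjoint_twist[of 0 g] by (simp add: twist_0)
qed

lemma is_adjoint_lreg: "f \<in> Cc \<Longrightarrow> is_adjoint (lreg f) (lreg (involution f))"
  unfolding lreg_eq_lincomb by (intro is_adjoint_lincomb is_adjoint_unitary_translation)

lemma lreg_delta: "lreg (delta g) = unitary_translation g"
  by (simp add: lreg_eq_lincomb lincomb_delta)

lemma unitary_translation_zero: "unitary_translation 0 = id_blinfun"
  by (auto intro!: blinfun_eqI ell2_eqI)

lemma lreg_add: "f \<in> Cc \<Longrightarrow> f' \<in> Cc \<Longrightarrow> lreg (f + f') = lreg f + lreg f'"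
  by (simp add: lreg_eq_lincomb lincomb_add)

lemma lreg_cscale: "f \<in> Cc \<Longrightarrow> lreg (cscale c f) = cscale_op c (lreg f)"
  by (simp add: lreg_eq_lincomb lincomb_cscale)

lemma cscale_op_compose_left: "cscale_op c T o\<^sub>L R = cscale_op c (T o\<^sub>L R)"
  by (auto intro!: blinfun_eqI)

text \<open>Elements of the ambient operator space are only real-linear, so complex homogeneity of
  the product in its second factor has to be carried from the group algebra to its closure.\<close>

definition complex_linear_op :: "('g ell2 \<Rightarrow>\<^sub>L 'g ell2) \<Rightarrow> bool" where
  "complex_linear_op T \<longleftrightarrow> (\<forall>c x. blinfun_apply T (cscale c x) = cscale c (blinfun_apply T x))"

lemma cscale_op_compose_right:
  "complex_linear_op T \<Longrightarrow> T o\<^sub>L cscale_op c R = cscale_op c (T o\<^sub>L R)"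
  by (auto intro!: blinfun_eqI simp: complex_linear_op_def)

lemma complex_linear_op_lreg: "complex_linear_op (lreg f)"
  unfolding complex_linear_op_def
  by (auto intro!: ell2_eqI simp: lreg_eq_lincomb coeff_lincomb sum_distrib_left mult.left_commute)

section \<open>The group algebra and its norm closure\<close>

abbreviation group_alg :: "('g::group_add ell2 \<Rightarrow>\<^sub>L 'g ell2) set" where
  "group_alg \<equiv> lreg ` Cc"

lemma group_alg_add: "T \<in> group_alg \<Longrightarrow> R \<in> group_alg \<Longrightarrow> T + R \<in> group_alg"
  by (auto simp: lreg_add[symmetric] intro!: imageI Cc_add)

lemma group_alg_cscale_op: "T \<in> group_alg \<Longrightarrow> cscale_op c T \<in> group_alg"
  by (auto simp: lreg_cscale[symmetric] intro!: imageI Cc_cscale)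

lemma unitary_translation_in_group_alg: "unitary_translation g \<in> group_alg"
  by (auto simp: lreg_delta[symmetric] intro!: imageI delta_in_Cc)

lemma group_alg_zero: "0 \<in> group_alg"
  using group_alg_cscale_op[OF unitary_translation_in_group_alg, of 0 0] by simp

lemma group_alg_sum: "(\<And>i. i \<in> I \<Longrightarrow> T i \<in> group_alg) \<Longrightarrow> sum T I \<in> group_alg"
  by (induction I rule: infinite_finite_induct) (auto intro!: group_alg_add group_alg_zero)

lemma group_alg_compose:
  assumes "T \<in> group_alg" "R \<in> group_alg"
  shows "T o\<^sub>L R \<in> group_alg"
proof -
  obtain f f' where f: "T = lreg f" "R = lreg f'" using assms by blast
  \<comment> \<open>This is the convolution product, kept as a double sum of translations so that
    closure under sums and multiples applies directly.\<close>
  have "T o\<^sub>L R = (\<Sum>g | coeff f g \<noteq> 0. \<Sum>h | coeff f' h \<noteq> 0.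
      cscale_op (coeff f g * coeff f' h) (unitary_translation (g + h)))"
    by (auto intro!: blinfun_eqI ell2_eqI simp: f lreg_eq_lincomb coeff_lincomb coeff_sum
        blinfun.sum_left sum_distrib_left minus_add diff_conv_add_uminus add.assoc mult.assoc
        simp del: add_uminus_conv_diff)
  then show ?thesis
    by (auto intro!: group_alg_sum group_alg_cscale_op unitary_translation_in_group_alg)
qed

lemma bounded_linear_cscale_op: "bounded_linear (cscale_op c)"
proof (rule bounded_linear_intro)
  fix T R :: "'a ell2 \<Rightarrow>\<^sub>L 'a ell2" and t :: real
  show "cscale_op c (T + R) = cscale_op c T + cscale_op c R"
    by (rule cscale_op_add_right)
  show "cscale_op c (t *\<^sub>R T) = t *\<^sub>R cscale_op c T"
    by (simp add: cscale_op_of_real[symmetric] mult.commute)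
  show "norm (cscale_op c T) \<le> norm T * cmod c"
    by (simp add: norm_cscale_op mult.commute)
qed

abbreviation group_cstar :: "('g::group_add ell2 \<Rightarrow>\<^sub>L 'g ell2) set" where
  "group_cstar \<equiv> closure group_alg"

lemma group_cstar_complex_linear:
  fixes T :: "'g::group_add ell2 \<Rightarrow>\<^sub>L 'g ell2"
  assumes "T \<in> group_cstar"
  shows "complex_linear_op T"
proof -
  have "blinfun_apply T (cscale c x) = cscale c (blinfun_apply T x)" for c x
  proof -
    let ?C = "{T :: 'g ell2 \<Rightarrow>\<^sub>L 'g ell2. blinfun_apply T (cscale c x) = cscale c (blinfun_apply T x)}"
    have "closed ?C"
      by (intro closed_Collect_eq bounded_linear.continuous_on[OF bounded_linear_cscale])
        (auto intro!: continuous_intros)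
    moreover have "group_alg \<subseteq> ?C"
      using complex_linear_op_lreg by (auto simp: complex_linear_op_def)
    ultimately have "group_cstar \<subseteq> ?C" by (rule closure_minimal[rotated])
    then show ?thesis using assms by blast
  qed
  then show ?thesis by (simp add: complex_linear_op_def)
qed

lemma group_cstar_add:
  assumes "T \<in> group_cstar" "R \<in> group_cstar"
  shows "T + R \<in> group_cstar"
proof -
  from assms obtain T' R' where "\<And>n. T' n \<in> group_alg" "\<And>n. R' n \<in> group_alg" "T' \<longlonglongrightarrow> T" "R' \<longlonglongrightarrow> R"
    unfolding closure_sequential by blast
  then show ?thesis
    unfolding closure_sequential
    by (intro exI[of _ "\<lambda>n. T' n + R' n"]) (auto intro!: group_alg_add tendsto_add)
qed

lemma group_cstar_compose:
  assumes "T \<in> group_cstar" "R \<in> group_cstar"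
  shows "T o\<^sub>L R \<in> group_cstar"
proof -
  from assms obtain T' R' where "\<And>n. T' n \<in> group_alg" "\<And>n. R' n \<in> group_alg" "T' \<longlonglongrightarrow> T" "R' \<longlonglongrightarrow> R"
    unfolding closure_sequential by blast
  then show ?thesis
    unfolding closure_sequential
    by (intro exI[of _ "\<lambda>n. T' n o\<^sub>L R' n"])
      (auto intro!: group_alg_compose bounded_bilinear.tendsto[OF bounded_bilinear_blinfun_compose])
qed

lemma group_cstar_cscale_op:
  assumes "T \<in> group_cstar"
  shows "cscale_op c T \<in> group_cstar"
proof -
  from assms obtain T' where "\<And>n. T' n \<in> group_alg" "T' \<longlonglongrightarrow> T"
    unfolding closure_sequential by blast
  then show ?thesis
    unfolding closure_sequential
    by (intro exI[of _ "\<lambda>n. cscale_op c (T' n)"])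
      (auto intro!: group_alg_cscale_op bounded_linear.tendsto[OF bounded_linear_cscale_op])
qed

lemma group_cstar_adjoint:
  assumes "T \<in> group_cstar"
  shows "adjoint_op T \<in> group_cstar" "is_adjoint T (adjoint_op T)"
proof -
  from assms obtain T' where T': "\<And>n. T' n \<in> group_alg" "T' \<longlonglongrightarrow> T"
    unfolding closure_sequential by blast
  then have "\<exists>f. f \<in> Cc \<and> T' n = lreg f" for n by blast
  then obtain f where f: "\<And>n. f n \<in> Cc" "\<And>n. T' n = lreg (f n)" by metis
  have "is_adjoint (T' n) (lreg (involution (f n)))" for n
    unfolding f(2) by (rule is_adjoint_lreg[OF f(1)])
  from is_adjoint_limit[OF this T'(2)] obtain R
    where R: "(\<lambda>n. lreg (involution (f n))) \<longlonglongrightarrow> R" "is_adjoint T R" by blast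
  have "R \<in> group_cstar"
    unfolding closure_sequential using R(1) f(1) involution_in_Cc
    by (intro exI[of _ "\<lambda>n. lreg (involution (f n))"]) auto
  then show "adjoint_op T \<in> group_cstar" "is_adjoint T (adjoint_op T)"
    using R(2) adjoint_op_eqI[OF R(2)] by auto
qed

interpretation cscale_op: vector_space cscale_op
  by unfold_locales (auto simp: cscale_op_add_left cscale_op_add_right)

lemma reduced_group_cstar_simps [simp]:
  "carrier reduced_group_cstar = group_cstar" "smult reduced_group_cstar = cscale_op"
  "mult reduced_group_cstar = (o\<^sub>L)" "unit reduced_group_cstar = id_blinfun"
  "star reduced_group_cstar = adjoint_op"
  by (simp_all add: reduced_group_cstar_def)

lemma unital_cstar_algebra_reduced_group_cstar:
  "unital_cstar_algebra (reduced_group_cstar :: ('g::group_add ell2 \<Rightarrow>\<^sub>L 'g ell2) cstar)"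
proof (unfold_locales, unfold reduced_group_cstar_simps)
  show "id_blinfun \<in> group_cstar"
    using unitary_translation_in_group_alg[of 0]
    by (intro subsetD[OF closure_subset]) (simp add: unitary_translation_zero)
  show "complete group_cstar"
    by (simp add: complete_eq_closed)
  show "module.subspace cscale_op group_cstar"
    unfolding cscale_op.subspace_def
    using subsetD[OF closure_subset group_alg_zero]
    by (auto intro: group_cstar_add group_cstar_cscale_op)
  fix T R Q :: "'g ell2 \<Rightarrow>\<^sub>L 'g ell2" and c
  assume T: "T \<in> group_cstar"
  note T' = group_cstar_adjoint[OF T]
  show "adjoint_op T \<in> group_cstar" by (rule T')
  show "adjoint_op (adjoint_op T) = T"
    by (rule adjoint_op_eqI[OF is_adjoint_sym[OF T'(2)]])
  show "adjoint_op (cscale_op c T) = cscale_op (cnj c) (adjoint_op T)"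
    by (rule adjoint_op_eqI[OF is_adjoint_cscale_op[OF T'(2)]])
  show "norm (adjoint_op T o\<^sub>L T) = (norm T)\<^sup>2"
    by (rule is_adjoint_norm_compose[OF T'(2)])
  assume R: "R \<in> group_cstar"
  note R' = group_cstar_adjoint[OF R]
  show "T o\<^sub>L R \<in> group_cstar" using T R by (rule group_cstar_compose)
  show "cscale_op c T o\<^sub>L R = cscale_op c (T o\<^sub>L R)" by (rule cscale_op_compose_left)
  show "T o\<^sub>L cscale_op c R = cscale_op c (T o\<^sub>L R)"
    by (rule cscale_op_compose_right[OF group_cstar_complex_linear[OF T]])
  show "adjoint_op (T + R) = adjoint_op T + adjoint_op R"
    by (rule adjoint_op_eqI[OF is_adjoint_add[OF T'(2) R'(2)]])
  show "adjoint_op (T o\<^sub>L R) = adjoint_op R o\<^sub>L adjoint_op T"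
    by (rule adjoint_op_eqI[OF is_adjoint_compose[OF T'(2) R'(2)]])
  show "norm (T o\<^sub>L R) \<le> norm T * norm R" by (rule norm_blinfun_compose)
qed (auto intro!: blinfun_eqI simp: cscale_op_add_left cscale_op_add_right cscale_op_of_real
      norm_cscale_op blinfun.add_left blinfun.add_right)

section \<open>States of a unital C*-algebra\<close>

context unital_cstar_algebra
begin

lemma
  shows carrier_zero: "0 \<in> carrier A"
    and carrier_add: "\<lbrakk>a \<in> carrier A; b \<in> carrier A\<rbrakk> \<Longrightarrow> a + b \<in> carrier A"
    and carrier_smult: "a \<in> carrier A \<Longrightarrow> smult A c a \<in> carrier A"
    and smult_zero_left: "smult A 0 a = 0"
proof -
  interpret vector_space "smult A" by (rule vector_space_smult)
  show "0 \<in> carrier A" "\<lbrakk>a \<in> carrier A; b \<in> carrier A\<rbrakk> \<Longrightarrow> a + b \<in> carrier A"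
    "a \<in> carrier A \<Longrightarrow> smult A c a \<in> carrier A" "smult A 0 a = 0"
    using subspace_carrier by (auto simp: subspace_def)
qed

lemma star_unit: "star A (unit A) = unit A"
  using mult_unit_right[OF star_closed[OF unit_closed]] star_mult[OF star_closed[OF unit_closed] unit_closed]
    star_star[OF unit_closed] by simp

text \<open>The C*-identity says that the norm of the unit equals its square. In the zero algebra it
  is 0, whence an inequality.\<close>

lemma norm_unit_le: "norm (unit A) \<le> 1"
  using cstar_identity[OF unit_closed]
  by (auto simp: star_unit mult_unit_left unit_closed power2_eq_square)

lemma
  assumes "\<phi> \<in> states A"
  shows state_add: "\<lbrakk>a \<in> carrier A; b \<in> carrier A\<rbrakk> \<Longrightarrow> \<phi> (a + b) = \<phi> a + \<phi> b"
    and state_smult: "a \<in> carrier A \<Longrightarrow> \<phi> (smult A c a) = c * \<phi> a"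
    and state_pos: "a \<in> carrier A \<Longrightarrow> \<phi> (mult A (star A a) a) \<in> \<real>\<^sub>\<ge>\<^sub>0"
    and state_SUP: "(SUP a\<in>{a \<in> carrier A. norm a \<le> 1}. ennreal (cmod (\<phi> a))) = 1"
    and state_extensional: "\<phi> \<in> extensional (carrier A)"
  using assms unfolding states_def by blast+

lemma state_zero: "\<phi> \<in> states A \<Longrightarrow> \<phi> 0 = 0"
  using state_smult[of \<phi> 0 0] carrier_zero by (simp add: smult_zero_left)

lemma state_diff:
  assumes "\<phi> \<in> states A" "a \<in> carrier A" "b \<in> carrier A"
  shows "a - b \<in> carrier A" "\<phi> (a - b) = \<phi> a - \<phi> b"
proof -
  interpret vector_space "smult A" by (rule vector_space_smult)
  have eq: "a - b = a + smult A (-1) b"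
    using smult_of_real[of "-1" b] by simp
  show "a - b \<in> carrier A"
    unfolding eq by (intro carrier_add carrier_smult assms)
  show "\<phi> (a - b) = \<phi> a - \<phi> b"
    unfolding eq using assms by (simp only: state_add state_smult carrier_smult) simp
qed

lemma state_sum:
  assumes "\<phi> \<in> states A" "\<And>i. i \<in> I \<Longrightarrow> a i \<in> carrier A"
  shows "\<phi> (sum a I) = (\<Sum>i\<in>I. \<phi> (a i))"
proof -
  have "sum a I \<in> carrier A \<and> \<phi> (sum a I) = (\<Sum>i\<in>I. \<phi> (a i))"
    using assms(2)
    by (induction I rule: infinite_finite_induct)
      (auto simp: assms(1) state_zero state_add carrier_zero carrier_add)
  then show ?thesis ..
qed

lemma state_norm_le:
  assumes \<phi>: "\<phi> \<in> states A" and a: "a \<in> carrier A"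
  shows "cmod (\<phi> a) \<le> norm a"
proof (cases "a = 0")
  case False
  let ?b = "smult A (of_real (inverse (norm a))) a"
  have "ennreal (cmod (\<phi> ?b)) \<le> (SUP a\<in>{a \<in> carrier A. norm a \<le> 1}. ennreal (cmod (\<phi> a)))"
    using False a by (intro SUP_upper) (simp add: carrier_smult norm_smult norm_inverse del: of_real_inverse)
  then have "cmod (\<phi> ?b) \<le> 1"
    by (simp add: state_SUP[OF \<phi>])
  then show ?thesis
    using False by (simp add: state_smult[OF \<phi> a] norm_mult norm_inverse norm_divide field_simps)
qed (simp add: state_zero \<phi>)

text \<open>Positivity of this expression for every scalar c yields both that the state is hermitian
  and a lower bound for its value on the unit.\<close>

lemma state_sesquilinear:
  assumes \<phi>: "\<phi> \<in> states A" and a: "a \<in> carrier A"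
  defines "b c \<equiv> a + smult A c (unit A)"
  shows "\<phi> (mult A (star A (b c)) (b c))
      = \<phi> (mult A (star A a) a) + c * \<phi> (star A a) + cnj c * \<phi> a + cnj c * c * \<phi> (unit A)"
proof -
  note cl = a unit_closed star_closed mult_closed carrier_smult carrier_add
  interpret vector_space "smult A" by (rule vector_space_smult)
  have "mult A (star A (b c)) (b c) = (mult A (star A a) a + smult A c (star A a))
      + (smult A (cnj c) a + smult A (cnj c) (smult A c (unit A)))"
    unfolding b_def
    by (simp only: cl star_add star_smult star_unit mult_add_left mult_add_right mult_smult_left
        mult_smult_right mult_unit_left mult_unit_right scale_right_distrib)
      (simp only: add_ac scale_left_commute)
  then show ?thesis
    by (simp only: \<phi> cl state_add state_smult) simp
qed

text \<open>With \<open>c = - \<phi> a / |\<phi> a|\<^sup>2\<close>, positivity of \<open>\<phi> ((a + c)\<^sup>* (a + c))\<close> gives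
  \<open>|\<phi> a|\<^sup>2 \<le> \<phi> 1\<close> for all \<open>a\<close> in the unit ball, without using square roots in the algebra.\<close>

lemma state_unit:
  assumes \<phi>: "\<phi> \<in> states A"
  shows "\<phi> (unit A) = 1"
proof (rule ccontr)
  let ?t = "\<phi> (unit A)"
  assume "?t \<noteq> 1"
  have t_pos: "?t \<in> \<real>\<^sub>\<ge>\<^sub>0"
    using state_pos[OF \<phi> unit_closed] by (simp add: star_unit mult_unit_left unit_closed)
  then obtain t where t: "?t = of_real t" "t \<ge> 0" by (auto elim: nonneg_Reals_cases)
  have "t \<le> 1"
    using state_norm_le[OF \<phi> unit_closed] norm_unit_le t by simp
  with \<open>?t \<noteq> 1\<close> t have t1: "t < 1" by (cases "t = 1") auto
  \<comment> \<open>As t < 1, also sqrt t lies below the supremum 1, so some a in the unit ball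
    violates the inequality that positivity will give.\<close>
  have "ennreal (sqrt t) < (SUP a\<in>{a \<in> carrier A. norm a \<le> 1}. ennreal (cmod (\<phi> a)))"
    using t1 t(2) by (simp add: state_SUP[OF \<phi>] ennreal_less_one_iff)
  then obtain a where a: "a \<in> carrier A" "norm a \<le> 1" "sqrt t < cmod (\<phi> a)"
    by (auto simp: less_SUP_iff ennreal_less_iff t(2))
  define z where "z = \<phi> a"
  define w where "w = \<phi> (star A a)"
  obtain p where p: "\<phi> (mult A (star A a) a) = of_real p" "p \<ge> 0"
    using state_pos[OF \<phi> a(1)] by (auto elim: nonneg_Reals_cases)
  have "p \<le> 1"
    using state_norm_le[OF \<phi>, of "mult A (star A a) a"] a cstar_identity[OF a(1)] p
      power_le_one[OF norm_ge_zero a(2), of 2] by (simp add: mult_closed star_closed)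
  have pos: "of_real p + c * w + cnj c * z + cnj c * c * of_real t \<in> \<real>\<^sub>\<ge>\<^sub>0" for c
    using state_pos[OF \<phi>, of "a + smult A c (unit A)"] state_sesquilinear[OF \<phi> a(1), of c] a(1)
    by (simp add: p t z_def w_def carrier_add carrier_smult unit_closed)
  \<comment> \<open>For c = 1 the number w + z must be real, for c = i the number i (w - z);
    together they say that w and z are conjugate.\<close>
  have "w = cnj z"
    using pos[of 1] pos[of \<i>] by (auto simp: complex_eq_iff complex_nonneg_Reals_iff)
  have z2: "t < (cmod z)\<^sup>2"
    using power_strict_mono[OF a(3), of 2] t(2) by (simp add: z_def)
  then have z0: "(cmod z)\<^sup>2 > 0" using t(2) by linarith
  define s where "s = inverse ((cmod z)\<^sup>2)"
  have "of_real p + (- of_real s * z) * cnj z + cnj (- of_real s * z) * z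
      + cnj (- of_real s * z) * (- of_real s * z) * of_real t
      = complex_of_real (p - 2 * (s * (cmod z)\<^sup>2) + s * (s * (cmod z)\<^sup>2) * t)"
    by (simp only: of_real_add of_real_diff of_real_mult of_real_numeral complex_norm_square) (simp add: algebra_simps)
  also have "\<dots> = complex_of_real (p - 2 + s * t)"
    using z0 by (simp add: s_def)
  finally have "complex_of_real (p - 2 + s * t) \<in> \<real>\<^sub>\<ge>\<^sub>0"
    using pos[of "- of_real s * z"] unfolding \<open>w = cnj z\<close> by (simp only:)
  then have "0 \<le> p - 2 + s * t" by (simp only: nonneg_Reals_of_real_iff)
  moreover have "s * t < 1"
    using z2 z0 by (simp add: s_def field_simps)
  ultimately show False using \<open>p \<le> 1\<close> by linarith
qed

end

section \<open>Polynomial growth\<close>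

lemma group_alg_subset_cstar: "T \<in> group_alg \<Longrightarrow> T \<in> group_cstar"
  by (rule subsetD[OF closure_subset])

interpretation group_cstar: unital_cstar_algebra reduced_group_cstar
  rewrites "carrier reduced_group_cstar = group_cstar" and "smult reduced_group_cstar = cscale_op"
    and "mult reduced_group_cstar = (o\<^sub>L)" and "unit reduced_group_cstar = id_blinfun"
    and "star reduced_group_cstar = adjoint_op"
  by (simp_all add: unital_cstar_algebra_reduced_group_cstar)

lemma state_lreg:
  assumes "\<phi> \<in> states reduced_group_cstar"
  shows "\<phi> (lreg f) = (\<Sum>g | coeff f g \<noteq> 0. coeff f g * \<phi> (unitary_translation g))"
  unfolding lreg_def using assms
  by (subst group_cstar.state_sum)
    (auto intro!: group_alg_subset_cstar group_alg_cscale_op unitary_translation_in_group_alg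
      simp: group_cstar.state_smult[OF assms group_alg_subset_cstar[OF unitary_translation_in_group_alg]])

lemma cmod_state_translation_le:
  assumes "\<phi> \<in> states reduced_group_cstar"
  shows "cmod (\<phi> (unitary_translation g)) \<le> 1"
  using group_cstar.state_norm_le[OF assms group_alg_subset_cstar[OF unitary_translation_in_group_alg], of g]
  by (simp add: norm_unitary_translation)

text \<open>States are contractive and the group algebra is dense in the carrier; outside the
  carrier extensionality decides.\<close>

lemma states_eqI:
  fixes \<phi> :: "('g::group_add ell2 \<Rightarrow>\<^sub>L 'g ell2) \<Rightarrow> complex"
  assumes "\<phi> \<in> states reduced_group_cstar" "\<psi> \<in> states reduced_group_cstar"
    and eq: "\<And>T. T \<in> group_alg \<Longrightarrow> \<phi> T = \<psi> T"
  shows "\<phi> = \<psi>"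
proof (rule extensionalityI)
  show "\<phi> \<in> extensional group_cstar" "\<psi> \<in> extensional group_cstar"
    using assms(1,2) by (auto dest: group_cstar.state_extensional)
  fix T :: "'g ell2 \<Rightarrow>\<^sub>L 'g ell2" assume T: "T \<in> group_cstar"
  have "cmod (\<phi> T - \<psi> T) \<le> e" if e: "e > 0" for e
  proof -
    obtain R where R: "R \<in> group_alg" "dist R T < e / 2"
      using T half_gt_zero[OF e] unfolding closure_approachable by blast
    note TR = T group_alg_subset_cstar[OF R(1)]
    have "cmod (\<phi> T - \<psi> T) = cmod (\<phi> (T - R) - \<psi> (T - R))"
      by (simp add: group_cstar.state_diff(2)[OF assms(1) TR] group_cstar.state_diff(2)[OF assms(2) TR] eq R)
    also have "\<dots> \<le> norm (T - R) + norm (T - R)"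
      using group_cstar.state_norm_le[OF _ group_cstar.state_diff(1)[OF assms(1) TR]] assms
      by (intro order.trans[OF norm_triangle_ineq4] add_mono) auto
    also have "\<dots> \<le> e" using R(2) by (simp add: dist_norm norm_minus_commute)
    finally show ?thesis .
  qed
  then have "cmod (\<phi> T - \<psi> T) \<le> 0" by (rule field_le_epsilon) simp
  then show "\<phi> T = \<psi> T" by simp
qed

section \<open>Tail estimates from polynomial growth\<close>

lemma sum_geometric_le:
  fixes q :: real
  assumes "0 \<le> q" "q < 1"
  shows "(\<Sum>j<J. q ^ j) \<le> 1 / (1 - q)"
  using assms by (simp add: geometric_sum[of q] sum_gp_strict) (simp add: divide_right_mono)

text \<open>The condition \<open>r < 2 * real k\<close> is what makes the series of l(g)^(-2k) over
  g \<noteq> 0 converge.\<close>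

locale growth = length_function l for l :: "'g::group_add \<Rightarrow> real" +
  fixes C r :: real and k :: nat
  assumes finite_ball: "finite {g. l g \<le> real n}"
    and card_ball_le: "real (card {g. l g \<le> real n}) \<le> C * (1 + real n) powr r"
    and C_pos: "0 < C" and r_ge_1: "1 \<le> r" and r_less: "r < 2 * real k"
begin

lemma k_pos: "0 < k"
  using r_ge_1 r_less by (cases k) auto

text \<open>The factor \<open>4 powr r\<close> comes from 1 + 2m \<le> 4m for m \<ge> 1, and the
  denominator from a geometric series whose ratio is the decay from one dyadic shell to the
  next.\<close>

definition tail_const :: real where
  "tail_const = C * 4 powr r / (1 - 2 powr (r - 2 * real k))"

lemma growth_rate_less_1: "2 powr (r - 2 * real k) < (1 :: real)"
  using r_less powr_less_mono[of "r - 2 * real k" 0 "2::real"] by simp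

lemma tail_const_pos: "0 < tail_const"
  unfolding tail_const_def using C_pos growth_rate_less_1 by simp

text \<open>Dyadic shells: the shell at radius \<open>2\<^sup>j n\<close> has at most \<open>C (4 \<cdot> 2\<^sup>j n)\<^sup>r\<close> elements.\<close>

lemma sum_inverse_power_le:
  assumes n: "1 \<le> n" and F: "finite F" "\<And>g. g \<in> F \<Longrightarrow> real n < l g"
  shows "(\<Sum>g\<in>F. (1 / l g ^ k)\<^sup>2) \<le> tail_const * real n powr (r - 2 * real k)"
proof -
  let ?q = "2 powr (r - 2 * real k) :: real"
  let ?B = "C * 4 powr r * real n powr (r - 2 * real k)"
  have step: "(\<Sum>g\<in>{g \<in> F. 2 ^ j * real n < l g \<and> l g \<le> 2 ^ Suc j * real n}. (1 / l g ^ k)\<^sup>2)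
      \<le> ?B * ?q ^ j" for j
  proof -
    define m where "m = 2 ^ j * n"
    let ?G = "{g \<in> F. 2 ^ j * real n < l g \<and> l g \<le> 2 ^ Suc j * real n}"
    have m_eq: "real m = 2 ^ j * real n" by (simp add: m_def)
    have "1 * 1 \<le> (2 ^ j * real n :: real)"
      using n by (intro mult_mono) auto
    then have m: "real m \<ge> 1" by (simp add: m_eq)
    have "(\<Sum>g\<in>?G. (1 / l g ^ k)\<^sup>2) \<le> real (card ?G) * real m powr (- 2 * real k)"
    proof (rule sum_bounded_above)
      fix g assume g: "g \<in> ?G"
      have "(1 / l g ^ k)\<^sup>2 = l g powr (- 2 * real k)"
        using g m by (auto simp: m_eq powr_minus powr_realpow[symmetric] powr_powr power2_eq_square
            powr_add[symmetric] field_simps)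
      also have "\<dots> \<le> real m powr (- 2 * real k)"
        using g m by (intro powr_mono2') (auto simp: m_eq)
      finally show "(1 / l g ^ k)\<^sup>2 \<le> real m powr (- 2 * real k)" .
    qed
    also have "real (card ?G) \<le> real (card {g. l g \<le> real (2 * m)})"
      by (intro of_nat_mono card_mono finite_ball) (auto simp: m_eq)
    also have "\<dots> \<le> C * (1 + real (2 * m)) powr r"
      by (rule card_ball_le)
    also have "\<dots> \<le> C * (4 * real m) powr r"
      using C_pos r_ge_1 m by (intro mult_left_mono powr_mono2) auto
    finally have "(\<Sum>g\<in>?G. (1 / l g ^ k)\<^sup>2) \<le> C * (4 * real m) powr r * real m powr (- 2 * real k)"
      by (simp add: mult_right_mono)
    also have "\<dots> = C * 4 powr r * real m powr (r - 2 * real k)"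
      using m by (simp add: powr_mult powr_add[symmetric] mult.assoc)
    also have "real m powr (r - 2 * real k) = real n powr (r - 2 * real k) * ?q ^ j"
      by (simp add: m_eq powr_mult powr_realpow[symmetric] powr_powr mult.commute)
    finally show ?thesis by (simp add: mult.assoc)
  qed
  have partial: "(\<Sum>g\<in>{g \<in> F. l g \<le> 2 ^ J * real n}. (1 / l g ^ k)\<^sup>2) \<le> ?B * (\<Sum>j<J. ?q ^ j)" for J
  proof (induction J)
    case 0
    have "{g \<in> F. l g \<le> 2 ^ 0 * real n} = {}" using F(2) by force
    then show ?case by (simp only: sum.empty) simp
  next
    case (Suc J)
    have le: "2 ^ J * real n \<le> 2 ^ Suc J * real n" by simp
    have "{g \<in> F. l g \<le> 2 ^ Suc J * real n}
        = {g \<in> F. l g \<le> 2 ^ J * real n} \<union> {g \<in> F. 2 ^ J * real n < l g \<and> l g \<le> 2 ^ Suc J * real n}"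
      by (auto simp del: power_Suc intro: order.trans[OF _ le])
    then have "(\<Sum>g\<in>{g \<in> F. l g \<le> 2 ^ Suc J * real n}. (1 / l g ^ k)\<^sup>2)
      = (\<Sum>g\<in>{g \<in> F. l g \<le> 2 ^ J * real n}. (1 / l g ^ k)\<^sup>2)
      + (\<Sum>g\<in>{g \<in> F. 2 ^ J * real n < l g \<and> l g \<le> 2 ^ Suc J * real n}. (1 / l g ^ k)\<^sup>2)"
      using F(1) by (simp only:) (rule sum.union_disjoint; auto)
    also have "\<dots> \<le> ?B * (\<Sum>j<J. ?q ^ j) + ?B * ?q ^ J"
      by (intro add_mono Suc.IH step)
    finally show ?case by (simp add: distrib_left)
  qed
  obtain M where M: "\<And>g. g \<in> F \<Longrightarrow> l g \<le> M"
    using bdd_above_finite[of "l ` F"] F(1) unfolding bdd_above_def by auto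
  obtain J where J: "M < 2 ^ J" using real_arch_pow[of 2 M] by auto
  \<comment> \<open>F is finite, so finitely many shells exhaust it.\<close>
  have "(2 ^ J :: real) * 1 \<le> 2 ^ J * real n"
    using n by (intro mult_left_mono) auto
  with J have "M \<le> 2 ^ J * real n" by linarith
  then have "{g \<in> F. l g \<le> 2 ^ J * real n} = F"
    using M by force
  then have "(\<Sum>g\<in>F. (1 / l g ^ k)\<^sup>2) \<le> ?B * (\<Sum>j<J. ?q ^ j)"
    using partial[of J] by simp
  also have "\<dots> \<le> ?B * (1 / (1 - ?q))"
    using C_pos growth_rate_less_1 by (intro mult_left_mono sum_geometric_le) auto
  finally show ?thesis by (simp add: tail_const_def mult_ac)
qed

definition tail_bound :: "nat \<Rightarrow> real" where
  "tail_bound n = sqrt (tail_const * real n powr (r - 2 * real k))"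

lemma tail_bound_nonneg: "0 \<le> tail_bound n"
  using tail_const_pos by (simp add: tail_bound_def)

lemma tail_bound_tendsto: "tail_bound \<longlonglongrightarrow> 0"
proof -
  have "(\<lambda>n. real n powr (r - 2 * real k)) \<longlonglongrightarrow> 0"
    using r_less by (intro tendsto_neg_powr filterlim_real_sequentially) auto
  then have "(\<lambda>n. sqrt (tail_const * real n powr (r - 2 * real k))) \<longlonglongrightarrow> sqrt (tail_const * 0)"
    by (intro tendsto_intros)
  then show ?thesis by (simp add: tail_bound_def[abs_def])
qed

text \<open>The weight \<open>l g ^ k\<close> is at least 1 for g \<noteq> 0 but vanishes at 0,
  where the seminorm leaves the coefficient unrestricted.\<close>

lemma
  assumes f: "f \<in> Cc" "norm (lincomb (twist k) f) \<le> 1"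
  shows cmod_coeff_le_1: "g \<noteq> 0 \<Longrightarrow> cmod (coeff f g) \<le> 1"
    and sum_coeff_tail_le:
      "1 \<le> n \<Longrightarrow> (\<Sum>g | coeff f g \<noteq> 0 \<and> real n < l g. cmod (coeff f g)) \<le> tail_bound n"
proof -
  have L2: "L2_set (\<lambda>g. l g ^ k * cmod (coeff f g)) F \<le> 1" if "finite F" for F
    using L2_set_le_norm_lincomb_twist[OF f(1) that, of k] f(2) by simp
  show "cmod (coeff f g) \<le> 1" if "g \<noteq> 0"
  proof -
    have "1 * cmod (coeff f g) \<le> l g ^ k * cmod (coeff f g)"
      using l_ge_1[OF that] by (intro mult_right_mono one_le_power) auto
    also have "\<dots> \<le> 1" using L2[of "{g}"] by (simp add: abs_mult l_nonneg)
    finally show ?thesis by simp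
  qed
  assume n: "1 \<le> n"
  let ?F = "{g. coeff f g \<noteq> 0 \<and> real n < l g}"
  have F: "finite ?F" using f(1) by (auto simp: Cc_def elim: rev_finite_subset)
  \<comment> \<open>On the tail l g > 0, so 1 may be written as
    \<open>l g ^ k * (1 / l g ^ k)\<close>; Cauchy-Schwarz then pairs the weighted coefficients with
    the convergent series.\<close>
  have "(\<Sum>g\<in>?F. cmod (coeff f g)) = (\<Sum>g\<in>?F. \<bar>l g ^ k * cmod (coeff f g)\<bar> * \<bar>1 / l g ^ k\<bar>)"
    by (intro sum.cong) (auto simp: abs_mult l_nonneg)
  also have "\<dots> \<le> L2_set (\<lambda>g. l g ^ k * cmod (coeff f g)) ?F * L2_set (\<lambda>g. 1 / l g ^ k) ?F"
    by (rule L2_set_mult_ineq)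
  also have "\<dots> \<le> 1 * tail_bound n"
  proof (intro mult_mono L2 F)
    show "L2_set (\<lambda>g. 1 / l g ^ k) ?F \<le> tail_bound n"
      unfolding L2_set_def tail_bound_def
      using sum_inverse_power_le[OF n F] by (intro real_sqrt_le_mono) auto
  qed auto
  finally show "(\<Sum>g\<in>?F. cmod (coeff f g)) \<le> tail_bound n" by simp
qed

end

section \<open>The compact quantum metric space\<close>

context growth
begin

abbreviation "states_G \<equiv> states (reduced_group_cstar :: ('g ell2 \<Rightarrow>\<^sub>L 'g ell2) cstar)"
abbreviation "ball_L \<equiv> unit_ball reduced_group_cstar (length_seminorm l k)"
abbreviation "dist_L \<equiv> (\<lambda>\<phi> \<psi>. enn2real (state_dist reduced_group_cstar (length_seminorm l k) \<phi> \<psi>))"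

section \<open>The metric on states\<close>

lemma unit_ballE:
  assumes "T \<in> ball_L"
  obtains f where "f \<in> Cc" "T = lreg f" "norm (lincomb (twist k) f) < 1"
proof -
  from assms have T: "length_seminorm l k T < 1" by (simp add: unit_ball_def)
  then have "T \<in> group_alg" by (auto simp: length_seminorm_def split: if_splits)
  then obtain f where f: "f \<in> Cc" "T = lreg f" by blast
  with T show ?thesis by (intro that[of f]) (auto simp: length_seminorm_lreg ennreal_less_one_iff)
qed

lemma unit_ballI:
  assumes "f \<in> Cc" "norm (lincomb (twist k) f) < 1"
  shows "lreg f \<in> ball_L"
  using assms
  by (auto simp: unit_ball_def length_seminorm_lreg ennreal_less_one_iff intro!: group_alg_subset_cstar)

lemma state_diff_unit_ball_le:
  assumes T: "T \<in> ball_L" and st: "\<phi> \<in> states_G" "\<psi> \<in> states_G" and n: "1 \<le> n"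
  shows "cmod (\<phi> T - \<psi> T) \<le>
    (\<Sum>g | l g \<le> real n. cmod (\<phi> (unitary_translation g) - \<psi> (unitary_translation g))) + 2 * tail_bound n"
proof -
  obtain f where f: "f \<in> Cc" "T = lreg f" "norm (lincomb (twist k) f) < 1"
    using T by (rule unit_ballE)
  let ?D = "\<lambda>g. cmod (\<phi> (unitary_translation g) - \<psi> (unitary_translation g))"
  let ?A = "{g. coeff f g \<noteq> 0 \<and> l g \<le> real n}" and ?B = "{g. coeff f g \<noteq> 0 \<and> real n < l g}"
  have fin: "finite ?A" "finite ?B"
    using f(1) by (auto simp: Cc_def elim: rev_finite_subset)
  have D2: "?D g \<le> 2" for g
    using cmod_state_translation_le[OF st(1), of g] cmod_state_translation_le[OF st(2), of g]
      norm_triangle_ineq4[of "\<phi> (unitary_translation g)" "\<psi> (unitary_translation g)"] by linarith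
  \<comment> \<open>The coefficient at the neutral element has no bound, but it multiplies the
    difference of two states at the unit, which is 0.\<close>
  have D0: "?D 0 = 0"
    by (simp add: unitary_translation_zero group_cstar.state_unit st)
  have "cmod (\<phi> T - \<psi> T)
      = cmod (\<Sum>g | coeff f g \<noteq> 0. coeff f g * (\<phi> (unitary_translation g) - \<psi> (unitary_translation g)))"
    by (simp add: f(2) state_lreg st sum_subtractf right_diff_distrib)
  also have "\<dots> \<le> (\<Sum>g | coeff f g \<noteq> 0. cmod (coeff f g) * ?D g)"
    by (rule order.trans[OF norm_sum]) (simp add: norm_mult)
  also have "{g. coeff f g \<noteq> 0} = ?A \<union> ?B" by auto
  also have "(\<Sum>g\<in>?A \<union> ?B. cmod (coeff f g) * ?D g)
      = (\<Sum>g\<in>?A. cmod (coeff f g) * ?D g) + (\<Sum>g\<in>?B. cmod (coeff f g) * ?D g)"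
    using fin by (intro sum.union_disjoint) auto
  also have "(\<Sum>g\<in>?A. cmod (coeff f g) * ?D g) \<le> (\<Sum>g\<in>?A. ?D g)"
  proof (rule sum_mono)
    fix g
    show "cmod (coeff f g) * ?D g \<le> ?D g"
      using cmod_coeff_le_1[OF f(1) less_imp_le[OF f(3)], of g] D0
      by (cases "g = 0") (auto intro: mult_left_le_one_le)
  qed
  also have "\<dots> \<le> (\<Sum>g | l g \<le> real n. ?D g)"
    by (intro sum_mono2 finite_ball) auto
  also have "(\<Sum>g\<in>?B. cmod (coeff f g) * ?D g) \<le> (\<Sum>g\<in>?B. cmod (coeff f g) * 2)"
    by (intro sum_mono mult_left_mono D2) auto
  also have "\<dots> \<le> 2 * tail_bound n"
    using sum_coeff_tail_le[OF f(1) less_imp_le[OF f(3)] n]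
    by (simp add: sum_distrib_right[symmetric])
  finally show ?thesis by simp
qed

lemma state_dist_le:
  assumes "\<phi> \<in> states_G" "\<psi> \<in> states_G" "1 \<le> n"
  shows "state_dist reduced_group_cstar (length_seminorm l k) \<phi> \<psi> \<le> ennreal
    ((\<Sum>g | l g \<le> real n. cmod (\<phi> (unitary_translation g) - \<psi> (unitary_translation g))) + 2 * tail_bound n)"
  unfolding state_dist_def
  by (intro SUP_least ennreal_leI state_diff_unit_ball_le assms)

lemma state_dist_finite:
  assumes "\<phi> \<in> states_G" "\<psi> \<in> states_G"
  shows "state_dist reduced_group_cstar (length_seminorm l k) \<phi> \<psi> < \<infinity>"
  using state_dist_le[OF assms order.refl] by (rule order.strict_trans1) simp

lemma dist_L_le:
  assumes "\<phi> \<in> states_G" "\<psi> \<in> states_G" "1 \<le> n"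
  shows "dist_L \<phi> \<psi> \<le>
    (\<Sum>g | l g \<le> real n. cmod (\<phi> (unitary_translation g) - \<psi> (unitary_translation g))) + 2 * tail_bound n"
  using state_dist_le[OF assms] tail_bound_nonneg[of n]
  by (intro enn2real_leI) (auto intro!: add_nonneg_nonneg sum_nonneg)

lemma state_diff_le_dist_L:
  assumes "T \<in> ball_L" "\<phi> \<in> states_G" "\<psi> \<in> states_G"
  shows "cmod (\<phi> T - \<psi> T) \<le> dist_L \<phi> \<psi>"
proof -
  have "ennreal (cmod (\<phi> T - \<psi> T)) \<le> state_dist reduced_group_cstar (length_seminorm l k) \<phi> \<psi>"
    unfolding state_dist_def using assms(1) by (rule SUP_upper)
  from enn2real_mono[OF this] state_dist_finite[OF assms(2,3)] show ?thesis by simp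
qed

lemma state_diff_le_mult_dist_L:
  assumes f: "f \<in> Cc" and st: "\<phi> \<in> states_G" "\<psi> \<in> states_G"
  shows "cmod (\<phi> (lreg f) - \<psi> (lreg f)) \<le> (norm (lincomb (twist k) f) + 1) * dist_L \<phi> \<psi>"
proof -
  \<comment> \<open>The summand 1 makes c positive when the seminorm vanishes and places f / c
    strictly inside the open unit ball.\<close>
  define c where "c = norm (lincomb (twist k) f) + 1"
  have c: "c > 0" by (simp add: c_def add_nonneg_pos)
  let ?f = "cscale (of_real (inverse c)) f"
  have "norm (lincomb (twist k) ?f) < 1"
    using c by (simp add: lincomb_cscale f norm_cscale_op norm_inverse norm_divide field_simps) (simp add: c_def)
  then have "cmod (\<phi> (lreg ?f) - \<psi> (lreg ?f)) \<le> dist_L \<phi> \<psi>"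
    by (intro state_diff_le_dist_L unit_ballI Cc_cscale f st)
  moreover have "\<rho> (lreg ?f) = of_real (inverse c) * \<rho> (lreg f)" if "\<rho> \<in> states_G" for \<rho>
    unfolding lreg_cscale[OF f] using that f
    by (intro group_cstar.state_smult group_alg_subset_cstar) auto
  ultimately have "cmod (of_real (inverse c) * (\<phi> (lreg f) - \<psi> (lreg f))) \<le> dist_L \<phi> \<psi>"
    by (simp add: st right_diff_distrib)
  then show ?thesis
    using c unfolding c_def[symmetric] by (simp add: norm_mult norm_inverse norm_divide field_simps)
qed

lemma Metric_space_dist_L: "Metric_space states_G dist_L"
proof
  fix \<phi> \<psi> \<rho>
  show "0 \<le> dist_L \<phi> \<psi>" by simp
  show "dist_L \<phi> \<psi> = dist_L \<psi> \<phi>"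
    by (simp add: state_dist_def norm_minus_commute)
  assume st: "\<phi> \<in> states_G" "\<psi> \<in> states_G"
  show "dist_L \<phi> \<psi> = 0 \<longleftrightarrow> \<phi> = \<psi>"
  proof
    assume "dist_L \<phi> \<psi> = 0"
    then have "cmod (\<phi> (lreg f) - \<psi> (lreg f)) \<le> 0" if "f \<in> Cc" for f
      using state_diff_le_mult_dist_L[OF that st] by simp
    then show "\<phi> = \<psi>" by (intro states_eqI st) auto
  next
    assume "\<phi> = \<psi>"
    then show "dist_L \<phi> \<psi> = 0"
      by (simp add: state_dist_def SUP_constant bot_ennreal)
  qed
  assume \<rho>: "\<rho> \<in> states_G"
  have "state_dist reduced_group_cstar (length_seminorm l k) \<phi> \<rho> \<le> ennreal (dist_L \<phi> \<psi> + dist_L \<psi> \<rho>)"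
    unfolding state_dist_def[of _ _ \<phi> \<rho>]
  proof (intro SUP_least ennreal_leI)
    fix T assume T: "T \<in> ball_L"
    have "cmod (\<phi> T - \<rho> T) \<le> cmod (\<phi> T - \<psi> T) + cmod (\<psi> T - \<rho> T)"
      using norm_triangle_ineq[of "\<phi> T - \<psi> T" "\<psi> T - \<rho> T"] by simp
    also have "\<dots> \<le> dist_L \<phi> \<psi> + dist_L \<psi> \<rho>"
      by (intro add_mono state_diff_le_dist_L T st \<rho>)
    finally show "cmod (\<phi> T - \<rho> T) \<le> dist_L \<phi> \<psi> + dist_L \<psi> \<rho>" .
  qed
  then show "dist_L \<phi> \<rho> \<le> dist_L \<phi> \<psi> + dist_L \<psi> \<rho>"
    by (intro enn2real_leI) auto
qed

section \<open>Comparison with the weak-* topology\<close>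

lemma topspace_weak_star:
  "topspace (weak_star_topology (reduced_group_cstar :: ('g ell2 \<Rightarrow>\<^sub>L 'g ell2) cstar)) = states_G"
  unfolding weak_star_topology_def
  by (auto simp: PiE_def dest: group_cstar.state_extensional)

lemma continuous_map_weak_star_eval:
  "T \<in> group_cstar \<Longrightarrow> continuous_map (weak_star_topology reduced_group_cstar) euclidean (\<lambda>\<phi>. \<phi> T)"
  unfolding weak_star_topology_def
  by (intro continuous_map_from_subtopology continuous_map_product_projection) simp

text \<open>Evaluation at an element of the group algebra is Lipschitz for d_L. Contractivity of
  states makes evaluation at T a uniform limit of such functions.\<close>

lemma continuous_map_dist_L_eval:
  assumes T: "T \<in> group_cstar"
  shows "continuous_map (Metric_space.mtopology states_G dist_L) euclidean (\<lambda>\<phi>. \<phi> T)"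
proof -
  interpret Metric_space states_G dist_L by (rule Metric_space_dist_L)
  have "\<exists>\<delta>>0. \<forall>\<psi>. \<psi> \<in> states_G \<and> dist_L \<phi> \<psi> < \<delta> \<longrightarrow> dist (\<phi> T) (\<psi> T) < \<epsilon>"
    if \<phi>: "\<phi> \<in> states_G" and \<epsilon>: "\<epsilon> > 0" for \<phi> \<epsilon>
  proof -
    obtain R where R: "R \<in> group_alg" "dist R T < \<epsilon> / 4"
      using T \<epsilon> unfolding closure_approachable by (meson zero_less_divide_iff zero_less_numeral)
    then obtain f where f: "f \<in> Cc" "R = lreg f" by blast
    note TR = T group_alg_subset_cstar[OF R(1)]
    define M where "M = norm (lincomb (twist k) f) + 1"
    have M: "M > 0" by (simp add: M_def add_nonneg_pos)
    have close: "cmod (\<rho> T - \<rho> R) \<le> \<epsilon> / 4" if "\<rho> \<in> states_G" for \<rho>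
      using group_cstar.state_norm_le[OF that group_cstar.state_diff(1)[OF that TR]] R(2)
      by (simp add: group_cstar.state_diff(2)[OF that TR] dist_norm norm_minus_commute)
    have "dist (\<phi> T) (\<psi> T) < \<epsilon>" if \<psi>: "\<psi> \<in> states_G" "dist_L \<phi> \<psi> < \<epsilon> / (2 * M)" for \<psi>
    proof -
      have "cmod (\<phi> R - \<psi> R) \<le> M * dist_L \<phi> \<psi>"
        unfolding f(2) M_def by (rule state_diff_le_mult_dist_L[OF f(1) \<phi> \<psi>(1)])
      also have "\<dots> < \<epsilon> / 2" using \<psi>(2) M by (simp add: field_simps)
      finally have "cmod (\<phi> R - \<psi> R) < \<epsilon> / 2" .
      moreover have "cmod (\<phi> T - \<psi> T) \<le> cmod (\<phi> T - \<phi> R) + cmod (\<phi> R - \<psi> R) + cmod (\<psi> T - \<psi> R)"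
        using norm_triangle_ineq[of "\<phi> T - \<phi> R" "\<phi> R - \<psi> T"] norm_triangle_ineq[of "\<phi> R - \<psi> R" "\<psi> R - \<psi> T"]
        by (simp add: norm_minus_commute)
      ultimately show ?thesis
        using close[OF \<phi>] close[OF \<psi>(1)] by (simp add: dist_norm)
    qed
    then show ?thesis using M \<epsilon> by (intro exI[of _ "\<epsilon> / (2 * M)"]) auto
  qed
  then show ?thesis
    using metric_continuous_map[OF Met_TC.Metric_space_axioms, of "\<lambda>\<phi>. \<phi> T"]
    by (simp add: mtopology_is_euclidean)
qed

lemma mtopology_dist_L:
  "Metric_space.mtopology states_G dist_L = weak_star_topology reduced_group_cstar"
proof -
  interpret Metric_space states_G dist_L by (rule Metric_space_dist_L)
  let ?W = "weak_star_topology (reduced_group_cstar :: ('g ell2 \<Rightarrow>\<^sub>L 'g ell2) cstar)"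
  have "continuous_map mtopology ?W (\<lambda>\<phi>. \<phi>)"
    unfolding weak_star_topology_def continuous_map_in_subtopology continuous_map_componentwise
    by (auto dest: group_cstar.state_extensional intro: continuous_map_dist_L_eval)
  then have 1: "openin mtopology U" if "openin ?W U" for U
    using openin_continuous_map_preimage[OF _ that, of mtopology "\<lambda>\<phi>. \<phi>"] openin_subset[OF that]
    by (simp add: topspace_weak_star Int_absorb1 Collect_conj_eq)
  have 2: "openin ?W U" if U: "openin mtopology U" for U
  proof (subst openin_subopen, intro ballI)
    fix \<phi> assume \<phi>: "\<phi> \<in> U"
    then obtain e where e: "e > 0" "mball \<phi> e \<subseteq> U" using U unfolding openin_mtopology by blast
    have \<phi>': "\<phi> \<in> states_G" using U \<phi> unfolding openin_mtopology by blast
    \<comment> \<open>Half of e is reserved for the tail \<open>2 * tail_bound n\<close>. The other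
      half bounds a finite sum of evaluations, which cuts out a weak-* neighbourhood.\<close>
    have "\<forall>\<^sub>F n in sequentially. tail_bound n < e / 4"
      using tail_bound_tendsto e(1) by (intro order_tendstoD) auto
    then have "\<forall>\<^sub>F n in sequentially. tail_bound n < e / 4 \<and> 1 \<le> n"
      using eventually_ge_at_top by (rule eventually_conj)
    then obtain n where n: "tail_bound n < e / 4" "1 \<le> n"
      unfolding eventually_sequentially by blast
    let ?h = "\<lambda>\<psi>. \<Sum>g | l g \<le> real n. cmod (\<phi> (unitary_translation g) - \<psi> (unitary_translation g))"
    let ?V = "{\<psi> \<in> topspace ?W. ?h \<psi> \<in> {..< e / 2}}"
    have "continuous_map ?W euclidean ?h"
      by (intro continuous_map_sum continuous_map_norm continuous_map_diff
          continuous_map_weak_star_eval finite_ball group_alg_subset_cstar unitary_translation_in_group_alg)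
        auto
    then have "openin ?W ?V"
      by (rule openin_continuous_map_preimage) simp
    moreover have "\<phi> \<in> ?V" using \<phi>' e(1) by (simp add: topspace_weak_star)
    moreover have "?V \<subseteq> U"
    proof
      fix \<psi> assume \<psi>: "\<psi> \<in> ?V"
      then have \<psi>': "\<psi> \<in> states_G" by (simp add: topspace_weak_star)
      have "dist_L \<phi> \<psi> < e"
        using dist_L_le[OF \<phi>' \<psi>' n(2)] n(1) \<psi> by simp
      then have "\<psi> \<in> mball \<phi> e" using \<phi>' \<psi>' by simp
      then show "\<psi> \<in> U" using e(2) by blast
    qed
    ultimately show "\<exists>V. openin ?W V \<and> \<phi> \<in> V \<and> V \<subseteq> U" by blast
  qed
  show ?thesis
    using 1 2 by (auto simp: topology_eq)
qed

section \<open>Seminorm axioms, invariance under adjoints, and kernel\<close>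

lemma is_seminorm_length_seminorm: "is_seminorm reduced_group_cstar (length_seminorm l k)"
proof -
  have add: "length_seminorm l k (T + R) \<le> length_seminorm l k T + length_seminorm l k R" for T R
  proof (cases "T \<in> group_alg \<and> R \<in> group_alg")
    case True
    then obtain f f' where f: "f \<in> Cc" "f' \<in> Cc" "T = lreg f" "R = lreg f'" by blast
    then show ?thesis
      using norm_triangle_ineq[of "lincomb (twist k) f" "lincomb (twist k) f'"]
      by (simp add: lreg_add[symmetric] length_seminorm_lreg Cc_add lincomb_add
          ennreal_plus[symmetric] ennreal_leI del: ennreal_plus)
  qed (auto simp: length_seminorm_def)
  have scale: "length_seminorm l k (cscale_op c T) = ennreal (cmod c) * length_seminorm l k T" for c T
  proof (cases "T \<in> group_alg")
    case True
    then obtain f where "f \<in> Cc" "T = lreg f" by blast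
    then show ?thesis
      by (simp add: lreg_cscale[symmetric] length_seminorm_lreg Cc_cscale lincomb_cscale norm_cscale_op
          ennreal_mult)
  next
    case False
    show ?thesis
    proof (cases "c = 0")
      case True
      \<comment> \<open>Here T has infinite seminorm but 0 T = \<open>lreg 0\<close> lies in the
        group algebra; both sides are 0 by the convention
        \<open>0 * \<infinity> = 0\<close>.\<close>
      have "length_seminorm l k (lreg 0) = 0"
        by (subst length_seminorm_lreg) (auto simp: Cc_zero lincomb_def)
      then show ?thesis using True by (simp add: lreg_def)
    next
      case c: False
      then have "cscale_op c T \<notin> group_alg"
        using False group_alg_cscale_op[of "cscale_op c T" "inverse c"] by auto
      then show ?thesis using False c by (simp add: length_seminorm_def ennreal_mult_top)
    qed
  qed
  show ?thesis
    using add scale by (simp add: is_seminorm_def)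
qed

lemma length_seminorm_adjoint:
  assumes "T \<in> group_cstar"
  shows "length_seminorm l k (adjoint_op T) = length_seminorm l k T"
proof -
  have alg: "adjoint_op R \<in> group_alg \<and> length_seminorm l k (adjoint_op R) = length_seminorm l k R"
    if R: "R \<in> group_alg" for R
  proof -
    from R obtain f where f: "f \<in> Cc" "R = lreg f" by blast
    then show ?thesis
      using adjoint_op_eqI[OF is_adjoint_lreg[OF f(1)]] involution_in_Cc[OF f(1)]
      by (simp add: length_seminorm_lreg norm_lincomb_twist_involution)
  qed
  show ?thesis
  proof (cases "T \<in> group_alg")
    case False
    \<comment> \<open>The adjoint is an involution that preserves the group algebra, so it preserves
      the complement too, where both values are infinite.\<close>
    then have "adjoint_op T \<notin> group_alg"
      using alg[of "adjoint_op T"] group_cstar.star_star[OF assms] by auto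
    with False show ?thesis by (simp add: length_seminorm_def)
  qed (simp add: alg)
qed

lemma length_seminorm_eq_0_iff:
  "{T \<in> group_cstar. length_seminorm l k T = 0} = range (\<lambda>c. cscale_op c id_blinfun)"
proof safe
  fix T assume T: "length_seminorm l k T = 0"
  then have "T \<in> group_alg" by (auto simp: length_seminorm_def split: if_splits)
  then obtain f where f: "f \<in> Cc" "T = lreg f" by blast
  have 0: "norm (lincomb (twist k) f) = 0"
    using T by (simp add: f length_seminorm_lreg)
  have "coeff f g = 0" if "g \<noteq> 0" for g
  proof -
    have "0 < l g ^ k" using l_ge_1[OF that] by simp
    then show ?thesis
      using L2_set_le_norm_lincomb_twist[OF f(1), of "{g}" k] unfolding 0
      by (auto simp: abs_mult mult_le_0_iff)
  qed
  then have f_eq: "f = cscale (coeff f 0) (delta 0)"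
    by (intro ell2_eqI) auto
  have "T = lreg (cscale (coeff f 0) (delta 0))"
    unfolding f(2) using f_eq by (rule arg_cong)
  also have "\<dots> = cscale_op (coeff f 0) id_blinfun"
    by (simp add: lreg_cscale delta_in_Cc lreg_delta unitary_translation_zero)
  finally have "T = cscale_op (coeff f 0) id_blinfun" .
  then show "T \<in> range (\<lambda>c. cscale_op c id_blinfun)" by blast
next
  fix c
  have eq: "cscale_op c id_blinfun = lreg (cscale c (delta 0))"
    by (simp add: lreg_cscale delta_in_Cc lreg_delta unitary_translation_zero)
  show "cscale_op c id_blinfun \<in> group_cstar"
    unfolding eq by (intro group_alg_subset_cstar imageI Cc_cscale delta_in_Cc)
  \<comment> \<open>This rests on k > 0, since \<open>twist 0 0\<close> is the identity.\<close>
  have "twist k 0 = 0"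
    using norm_twist_le[of k 0] k_pos by (simp add: l_zero zero_power)
  then show "length_seminorm l k (cscale_op c id_blinfun) = 0"
    unfolding eq by (simp add: length_seminorm_lreg Cc_cscale delta_in_Cc lincomb_cscale lincomb_delta)
qed

lemma compact_quantum_metric_space_length_seminorm:
  "compact_quantum_metric_space reduced_group_cstar (length_seminorm l k)"
  unfolding compact_quantum_metric_space_def
proof (intro conjI ballI impI)
  fix \<phi> \<psi> assume st: "\<phi> \<in> states_G" "\<psi> \<in> states_G"
  show "state_dist reduced_group_cstar (length_seminorm l k) \<phi> \<psi> < \<infinity>"
    using st by (rule state_dist_finite)
  assume "\<phi> \<noteq> \<psi>"
  then obtain T where T: "T \<in> group_alg" "\<phi> T \<noteq> \<psi> T" using states_eqI[OF st] by blast
  then show "\<exists>a\<in>carrier reduced_group_cstar. length_seminorm l k a < \<infinity> \<and> \<phi> a \<noteq> \<psi> a"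
    by (intro bexI[of _ T]) (auto simp: length_seminorm_lreg group_alg_subset_cstar)
qed (simp_all add: unital_cstar_algebra_reduced_group_cstar is_seminorm_length_seminorm
    length_seminorm_adjoint length_seminorm_eq_0_iff Metric_space_dist_L mtopology_dist_L)

end

section \<open>Word length\<close>

definition word_norm :: "'g::group_add set \<Rightarrow> 'g \<Rightarrow> nat" where
  "word_norm S g = (LEAST n. \<exists>w\<in>words S. length w = n \<and> sum_list w = g)"

lemma word_length_eq: "word_length S g = real (word_norm S g)"
  by (simp add: word_length_def word_norm_def)

lemma word_norm_le: "w \<in> words S \<Longrightarrow> word_norm S (sum_list w) \<le> length w"
  unfolding word_norm_def by (rule Least_le) blast

lemma word_norm_witness:
  assumes "generates_group S"
  obtains w where "w \<in> words S" "length w = word_norm S g" "sum_list w = g"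
proof -
  have "\<exists>n. \<exists>w\<in>words S. length w = n \<and> sum_list w = g"
    using assms unfolding generates_group_def by blast
  from LeastI_ex[OF this] show ?thesis
    using that unfolding word_norm_def by blast
qed

lemma word_norm_zero: "word_norm S 0 = 0"
  using word_norm_le[of "[]" S] by (simp add: words_def)

lemma word_norm_pos:
  assumes "generates_group S" "g \<noteq> 0"
  shows "1 \<le> word_norm S g"
proof -
  obtain w where "w \<in> words S" "length w = word_norm S g" "sum_list w = g"
    using word_norm_witness[OF assms(1)] .
  then show ?thesis using assms(2) by (cases w) auto
qed

lemma word_norm_add:
  assumes "generates_group S"
  shows "word_norm S (g + h) \<le> word_norm S g + word_norm S h"
proof -
  obtain v where v: "v \<in> words S" "length v = word_norm S g" "sum_list v = g"
    using word_norm_witness[OF assms] .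
  obtain w where w: "w \<in> words S" "length w = word_norm S h" "sum_list w = h"
    using word_norm_witness[OF assms] .
  show ?thesis using word_norm_le[of "v @ w" S] v w by (simp add: words_def)
qed

lemma sum_list_map_uminus_rev: "sum_list (map uminus (rev w)) = - sum_list (w :: 'g::group_add list)"
  by (induction w) (auto simp: minus_add)

lemma word_norm_uminus:
  assumes "generates_group S"
  shows "word_norm S (- g) = word_norm S g"
proof -
  have le: "word_norm S (- h) \<le> word_norm S h" for h
  proof -
    obtain w where w: "w \<in> words S" "length w = word_norm S h" "sum_list w = h"
      using word_norm_witness[OF assms] .
    have "map uminus (rev w) \<in> words S"
      using w(1) by (fastforce simp: words_def in_lists_conv_set)
    from word_norm_le[OF this] show ?thesis
      by (simp add: w sum_list_map_uminus_rev)
  qed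
  show ?thesis using le[of g] le[of "- g"] by simp
qed

text \<open>Prefixes of a geodesic word are geodesic.\<close>

lemma word_norm_attained:
  assumes "generates_group S" "m \<le> word_norm S g"
  obtains h where "word_norm S h = m"
proof -
  obtain w where w: "w \<in> words S" "length w = word_norm S g" "sum_list w = g"
    using word_norm_witness[OF assms(1)] .
  have "take m w \<in> words S" "drop m w \<in> words S"
    using w(1) by (auto simp: words_def in_lists_conv_set dest: in_set_takeD in_set_dropD)
  then have "word_norm S (sum_list (take m w)) \<le> m"
    "word_norm S (sum_list (drop m w)) \<le> word_norm S g - m"
    using word_norm_le[of "take m w" S] word_norm_le[of "drop m w" S] w(2) assms(2) by auto
  \<comment> \<open>The two upper bounds add up to \<open>word_norm S g\<close>, so subadditivity
    forces equality in both.\<close>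
  moreover have "word_norm S g \<le> word_norm S (sum_list (take m w)) + word_norm S (sum_list (drop m w))"
    using word_norm_add[OF assms(1), of "sum_list (take m w)" "sum_list (drop m w)"] w(3)
    by (metis append_take_drop_id sum_list_append)
  ultimately show ?thesis
    using assms(2) by (intro that[of "sum_list (take m w)"]) linarith
qed

lemma length_function_word_length:
  assumes "generates_group S"
  shows "length_function (word_length S)"
  using word_norm_zero[of S] word_norm_pos[OF assms] word_norm_uminus[OF assms] word_norm_add[OF assms]
  by unfold_locales (auto simp: word_length_eq simp flip: of_nat_add)

text \<open>A finite ball cannot exhaust an infinite group, so some element is longer than n. Every
  length from 0 to n then occurs along a geodesic to it, and different lengths belong to different
  elements.\<close>

lemma card_word_ball_ge:
  assumes inf: "infinite (UNIV :: 'g::group_add set)" and gen: "generates_group (S :: 'g set)"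
    and fin: "finite {g. word_length S g \<le> real n}"
  shows "n + 1 \<le> card {g. word_length S g \<le> real n}"
proof -
  have "\<exists>g. real n < word_length S g"
  proof (rule ccontr)
    assume "\<nexists>g. real n < word_length S g"
    then have "{g. word_length S g \<le> real n} = UNIV" by (auto simp: not_less)
    then show False using inf fin by simp
  qed
  then obtain g where g: "real n < word_length S g" ..
  have "{..n} \<subseteq> word_norm S ` {g. word_length S g \<le> real n}"
  proof
    fix m assume "m \<in> {..n}"
    moreover from this g obtain h where "word_norm S h = m"
      using word_norm_attained[OF gen, of m g] by (auto simp: word_length_eq)
    ultimately show "m \<in> word_norm S ` {g. word_length S g \<le> real n}"
      by (auto simp: word_length_eq intro!: rev_image_eqI[of h])
  qed
  then have "card {..n} \<le> card (word_norm S ` {g. word_length S g \<le> real n})"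
    using fin by (intro card_mono) auto
  also have "\<dots> \<le> card {g. word_length S g \<le> real n}"
    using fin by (rule card_image_le)
  finally show ?thesis by simp
qed

section \<open>Metric dimension\<close>

interpretation cscale: vector_space cscale
  by unfold_locales (auto simp: cscale_add_left cscale_add_right)

section \<open>Orthonormal systems and Bessel's inequality\<close>

lemma norm_add_orthogonal:
  assumes "cinner x y = 0"
  shows "(norm (x + y))\<^sup>2 = (norm x)\<^sup>2 + (norm y)\<^sup>2"
proof -
  have "complex_of_real ((norm (x + y))\<^sup>2) = complex_of_real ((norm x)\<^sup>2 + (norm y)\<^sup>2)"
    using assms cinner_commute[of y x]
    by (simp only: of_real_add cinner_self[symmetric] cinner_add_left cinner_add_right) simp
  then show ?thesis by (simp only: of_real_eq_iff)
qed

definition orthonormal :: "'g ell2 set \<Rightarrow> bool" where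
  "orthonormal U \<longleftrightarrow> (\<forall>u\<in>U. \<forall>v\<in>U. cinner u v = (if u = v then 1 else 0))"

lemma cinner_orthonormal_sum:
  assumes "orthonormal U" "finite U" "u \<in> U"
  shows "cinner u (\<Sum>v\<in>U. cscale (a v) v) = a u"
proof -
  have "cinner u (\<Sum>v\<in>U. cscale (a v) v) = (\<Sum>v\<in>U. if v = u then a u else 0)"
    unfolding cinner_sum_right using assms
    by (intro sum.cong) (auto simp: orthonormal_def cinner_cscale_right)
  then show ?thesis using assms by simp
qed

lemma orthogonal_residual:
  assumes "orthonormal U" "finite U" "u \<in> U"
  shows "cinner u (x - (\<Sum>v\<in>U. cscale (cinner v x) v)) = 0"
  using cinner_orthonormal_sum[OF assms] by (simp add: cinner_diff_right)

lemma gram_schmidt: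
  assumes "finite B"
  shows "\<exists>U. finite U \<and> card U \<le> card B \<and> orthonormal U \<and> B \<subseteq> cscale.span U"
  using assms
proof induction
  case empty
  show ?case by (intro exI[of _ "{}"]) (auto simp: orthonormal_def)
next
  case (insert b B)
  then obtain U where U: "finite U" "card U \<le> card B" "orthonormal U" "B \<subseteq> cscale.span U" by blast
  define p where "p = (\<Sum>v\<in>U. cscale (cinner v b) v)"
  define w where "w = b - p"
  have p: "p \<in> cscale.span U"
    unfolding p_def by (intro cscale.span_sum cscale.span_scale cscale.span_base)
  have orth: "cinner u w = 0" if "u \<in> U" for u
    unfolding w_def p_def using U(3,1) that by (rule orthogonal_residual)
  show ?case
  \<comment> \<open>B may be linearly dependent; a vanishing residual adds no vector, which is why
    the cardinality is only bounded.\<close>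
  proof (cases "w = 0")
    case True
    then show ?thesis
      using U insert.hyps p by (intro exI[of _ U]) (auto simp: w_def)
  next
    case False
    define v where "v = cscale (of_real (inverse (norm w))) w"
    have w_eq: "w = cscale (of_real (norm w)) v"
      using False by (simp add: v_def)
    have v1: "cinner v v = 1"
      using False by (simp add: cinner_self v_def norm_cscale norm_inverse norm_divide)
    have v0: "cinner u v = 0" if "u \<in> U" for u
      using orth[OF that] by (simp add: v_def cinner_cscale_right)
    have v0': "cinner v u = 0" if "u \<in> U" for u
      using v0[OF that] cinner_commute[of v u] by simp
    have "orthonormal (insert v U)"
      using U(3) v0 v0' v1 unfolding orthonormal_def by fastforce
    moreover have "b \<in> cscale.span (insert v U)"
    proof -
      have "p \<in> cscale.span (insert v U)"
        using p cscale.span_mono[of U "insert v U"] by blast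
      moreover have "w \<in> cscale.span (insert v U)"
        by (subst w_eq) (intro cscale.span_scale cscale.span_base insertI1)
      ultimately have "p + w \<in> cscale.span (insert v U)"
        by (rule cscale.span_add)
      then show ?thesis by (simp add: w_def)
    qed
    moreover have "B \<subseteq> cscale.span (insert v U)"
      using U(4) cscale.span_mono[of U "insert v U"] by blast
    ultimately show ?thesis
      using U insert.hyps by (intro exI[of _ "insert v U"]) (auto simp: card_insert_if)
  qed
qed

text \<open>The orthogonal projection p of x splits x - z into the orthogonal parts x - p and p - z;
  the squared norm of the first is the left-hand side.\<close>

lemma bessel_distance:
  assumes U: "orthonormal U" "finite U" and z: "z \<in> cscale.span U"
  shows "(norm x)\<^sup>2 - (\<Sum>u\<in>U. (cmod (cinner u x))\<^sup>2) \<le> (norm (x - z))\<^sup>2"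
proof -
  obtain a where a: "z = (\<Sum>u\<in>U. cscale (a u) u)"
    using z U(2) by (auto simp: cscale.span_finite)
  define p where "p = (\<Sum>u\<in>U. cscale (cinner u x) u)"
  define w where "w = x - p"
  have w0: "cinner w u = 0" if "u \<in> U" for u
    using orthogonal_residual[OF U that, of x] cinner_commute[of w u] by (simp add: w_def p_def)
  have orth: "cinner w y = 0" if "y \<in> cscale.span U" for y
    using that U(2) w0 by (auto simp: cscale.span_finite cinner_sum_right cinner_cscale_right)
  have p: "p \<in> cscale.span U"
    unfolding p_def by (intro cscale.span_sum cscale.span_scale cscale.span_base)
  have "cinner p p = (\<Sum>u\<in>U. cnj (cinner u x) * cinner u p)"
    unfolding p_def by (simp add: cinner_sum_left cinner_cscale_left)
  also have "\<dots> = (\<Sum>u\<in>U. of_real ((cmod (cinner u x))\<^sup>2))"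
    unfolding p_def
    by (intro sum.cong refl) (simp only: cinner_orthonormal_sum[OF U] complex_norm_square mult.commute)
  finally have "complex_of_real ((norm p)\<^sup>2) = complex_of_real (\<Sum>u\<in>U. (cmod (cinner u x))\<^sup>2)"
    by (simp only: cinner_self of_real_sum)
  then have np: "(norm p)\<^sup>2 = (\<Sum>u\<in>U. (cmod (cinner u x))\<^sup>2)"
    by (simp only: of_real_eq_iff)
  have "(norm x)\<^sup>2 = (norm w)\<^sup>2 + (norm p)\<^sup>2"
    using norm_add_orthogonal[OF orth[OF p]] by (simp add: w_def)
  moreover have "(norm (x - z))\<^sup>2 = (norm w)\<^sup>2 + (norm (p - z))\<^sup>2"
    using norm_add_orthogonal[OF orth[OF cscale.span_diff[OF p z]]] by (simp add: w_def)
  ultimately show ?thesis using np by simp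
qed

text \<open>Double counting of the squares |u(g)|^2: each g receives at least 1 - (1/2)^2 = 3/4 from
  all u by Bessel, and each unit vector u gives at most 1 to all g.\<close>

lemma card_le_of_approx_delta:
  assumes B: "finite B" and F: "finite F"
    and approx: "\<And>g. g \<in> F \<Longrightarrow> \<exists>z\<in>cscale.span B. norm (delta g - z) \<le> 1 / 2"
  shows "3 / 4 * real (card F) \<le> real (card B)"
proof -
  obtain U where U: "finite U" "card U \<le> card B" "orthonormal U" "B \<subseteq> cscale.span U"
    using gram_schmidt[OF B] by blast
  have span: "cscale.span B \<subseteq> cscale.span U"
    using U(4) by (intro cscale.span_minimal) auto
  have "3 / 4 \<le> (\<Sum>u\<in>U. (cmod (coeff u g))\<^sup>2)" if g: "g \<in> F" for g
  proof -
    obtain z where z: "z \<in> cscale.span U" "norm (delta g - z) \<le> 1 / 2"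
      using approx[OF g] span by blast
    have "(norm (delta g - z))\<^sup>2 \<le> (1 / 2)\<^sup>2"
      using z(2) by (intro power_mono) auto
    moreover have "cmod (cinner u (delta g)) = cmod (coeff u g)" for u
      using cinner_commute[of u "delta g"] by (simp add: cinner_delta)
    ultimately show ?thesis
      using bessel_distance[OF U(3,1) z(1), of "delta g"] by (simp add: power_divide)
  qed
  then have "(\<Sum>g\<in>F. 3 / 4) \<le> (\<Sum>g\<in>F. \<Sum>u\<in>U. (cmod (coeff u g))\<^sup>2)"
    by (rule sum_mono)
  also have "\<dots> = (\<Sum>u\<in>U. \<Sum>g\<in>F. (cmod (coeff u g))\<^sup>2)"
    by (rule sum.swap)
  also have "\<dots> \<le> (\<Sum>u\<in>U. 1)"
  proof (rule sum_mono)
    fix u assume "u \<in> U"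
    then have "complex_of_real ((norm u)\<^sup>2) = of_real 1"
      using U(3) by (simp add: cinner_self[symmetric] orthonormal_def del: of_real_power)
    then have "(norm u)\<^sup>2 = 1" by (simp only: of_real_eq_iff)
    then have "norm u = 1" using norm_ge_zero[of u] by (simp add: power2_eq_1_iff)
    then have "sqrt (\<Sum>g\<in>F. (cmod (coeff u g))\<^sup>2) \<le> 1"
      using L2_set_coeff_le_norm[OF F, of u] by (simp add: L2_set_def)
    then show "(\<Sum>g\<in>F. (cmod (coeff u g))\<^sup>2) \<le> 1" by simp
  qed
  finally show ?thesis using U(2) by (simp add: mult.commute)
qed

section \<open>Logarithms of dimensions and the limit superior\<close>

lemma ln_enat_ge:
  assumes "enat m \<le> D" "0 < x" "x \<le> real m"
  shows "ereal (ln x) \<le> ln_enat D"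
proof (cases D)
  case (enat d)
  then have "x \<le> real d" using assms by simp
  then show ?thesis using assms(2) enat by (auto simp: ln_enat_def)
qed (simp add: ln_enat_def)

lemma ln_enat_le:
  assumes "D \<le> enat m" "real m \<le> x"
  shows "ln_enat D \<le> ereal (ln x)"
proof (cases D)
  case (enat d)
  then have "real d \<le> x" using assms by simp
  then show ?thesis using enat by (auto simp: ln_enat_def)
qed (use assms in simp)

text \<open>ln (1 / \<delta>) tends to infinity, so multiplicative constants in a dimension estimate
  disappear and the exponent b remains.\<close>

lemma tendsto_affine_ln_ratio:
  "((\<lambda>\<delta>. ereal ((a + b * ln (1 / \<delta>)) / ln (1 / \<delta>))) \<longlongrightarrow> ereal b) (at_right (0::real))"
proof -
  have "((\<lambda>\<delta>. (a + b * ln (1 / \<delta>)) / ln (1 / \<delta>)) \<longlongrightarrow> b) (at_right (0::real))"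
    by real_asymp
  then show ?thesis by simp
qed

lemma Limsup_le_of_affine_ln:
  fixes f :: "real \<Rightarrow> ereal"
  assumes "\<And>\<delta>. 0 < \<delta> \<Longrightarrow> \<delta> < e \<Longrightarrow> f \<delta> \<le> ereal (a + b * ln (1 / \<delta>))" "0 < e"
  shows "Limsup (at_right 0) (\<lambda>\<delta>. f \<delta> / ereal (ln (1 / \<delta>))) \<le> ereal b"
proof -
  \<comment> \<open>Below \<delta> = 1 the denominator is positive, so division preserves the
    inequality.\<close>
  have "\<forall>\<^sub>F \<delta> in at_right (0::real). \<delta> < min e 1 \<and> 0 < \<delta>"
    using eventually_at_right_less[of "0::real"] assms(2)
    by (intro eventually_conj order_tendstoD(2)[OF tendsto_ident_at]) auto
  then have "\<forall>\<^sub>F \<delta> in at_right 0. f \<delta> / ereal (ln (1 / \<delta>)) \<le> ereal ((a + b * ln (1 / \<delta>)) / ln (1 / \<delta>))"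
  proof eventually_elim
    case (elim \<delta>)
    then have "0 < ln (1 / \<delta>)" by simp
    then show ?case
      using ereal_divide_right_mono[OF assms(1)[of \<delta>], of "ereal (ln (1 / \<delta>))"] elim by simp
  qed
  then have "Limsup (at_right 0) (\<lambda>\<delta>. f \<delta> / ereal (ln (1 / \<delta>)))
      \<le> Limsup (at_right 0) (\<lambda>\<delta>. ereal ((a + b * ln (1 / \<delta>)) / ln (1 / \<delta>)))"
    by (rule Limsup_mono)
  also have "\<dots> = ereal b"
    by (intro lim_imp_Limsup tendsto_affine_ln_ratio) simp
  finally show ?thesis .
qed

lemma Limsup_ge_of_affine_ln:
  fixes f :: "real \<Rightarrow> ereal"
  assumes "\<And>\<delta>. 0 < \<delta> \<Longrightarrow> \<delta> < e \<Longrightarrow> ereal (a + b * ln (1 / \<delta>)) \<le> f \<delta>" "0 < e"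
  shows "ereal b \<le> Limsup (at_right 0) (\<lambda>\<delta>. f \<delta> / ereal (ln (1 / \<delta>)))"
proof -
  have "\<forall>\<^sub>F \<delta> in at_right (0::real). \<delta> < min e 1 \<and> 0 < \<delta>"
    using eventually_at_right_less[of "0::real"] assms(2)
    by (intro eventually_conj order_tendstoD(2)[OF tendsto_ident_at]) auto
  then have "\<forall>\<^sub>F \<delta> in at_right 0. ereal ((a + b * ln (1 / \<delta>)) / ln (1 / \<delta>)) \<le> f \<delta> / ereal (ln (1 / \<delta>))"
  proof eventually_elim
    case (elim \<delta>)
    then have "0 < ln (1 / \<delta>)" by simp
    then show ?case
      using ereal_divide_right_mono[OF assms(1)[of \<delta>], of "ereal (ln (1 / \<delta>))"] elim by simp
  qed
  then have "Limsup (at_right 0) (\<lambda>\<delta>. ereal ((a + b * ln (1 / \<delta>)) / ln (1 / \<delta>)))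
      \<le> Limsup (at_right 0) (\<lambda>\<delta>. f \<delta> / ereal (ln (1 / \<delta>)))"
    by (rule Limsup_mono)
  moreover have "Limsup (at_right 0) (\<lambda>\<delta>. ereal ((a + b * ln (1 / \<delta>)) / ln (1 / \<delta>))) = ereal b"
    by (intro lim_imp_Limsup tendsto_affine_ln_ratio) simp
  ultimately show ?thesis by simp
qed

context growth
begin

section \<open>The two dimension bounds\<close>

lemma approx_dim_le_card_ball:
  assumes n: "1 \<le> n" "tail_bound n < \<delta>"
  shows "approx_dim reduced_group_cstar ball_L \<delta> \<le> enat (card {g. l g \<le> real n})"
proof -
  let ?B = "unitary_translation ` {g. l g \<le> real n}"
  have B: "finite ?B" using finite_ball by simp
  have "cscale_op.span ?B \<subseteq> group_cstar"
    using unital_cstar_algebra.subspace_carrier[OF unital_cstar_algebra_reduced_group_cstar]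
    by (intro cscale_op.span_minimal)
      (auto intro!: group_alg_subset_cstar unitary_translation_in_group_alg)
  moreover have "\<exists>z\<in>cscale_op.span ?B. norm (T - z) < \<delta>" if T: "T \<in> ball_L" for T
  proof -
    obtain f where f: "f \<in> Cc" "T = lreg f" "norm (lincomb (twist k) f) < 1"
      using T by (rule unit_ballE)
    let ?A = "{g. coeff f g \<noteq> 0 \<and> l g \<le> real n}" and ?A' = "{g. coeff f g \<noteq> 0 \<and> real n < l g}"
    let ?t = "\<lambda>g. cscale_op (coeff f g) (unitary_translation g)"
    have fin: "finite ?A" "finite ?A'"
      using f(1) by (auto simp: Cc_def elim: rev_finite_subset)
    have "T = sum ?t {g. coeff f g \<noteq> 0}"
      by (simp only: f(2) lreg_def)
    also have "{g. coeff f g \<noteq> 0} = ?A \<union> ?A'" by auto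
    also have "sum ?t (?A \<union> ?A') = sum ?t ?A + sum ?t ?A'"
      using fin by (intro sum.union_disjoint) auto
    finally have "norm (T - sum ?t ?A) = norm (sum ?t ?A')" by simp
    \<comment> \<open>Translations have norm 1, so the l1-norm of the tail dominates its operator
      norm.\<close>
    also have "\<dots> \<le> (\<Sum>g\<in>?A'. cmod (coeff f g))"
      by (rule order.trans[OF norm_sum]) (simp add: norm_cscale_op norm_unitary_translation)
    also have "\<dots> \<le> tail_bound n"
      using f(1) less_imp_le[OF f(3)] n(1) by (rule sum_coeff_tail_le)
    also have "\<dots> < \<delta>" by (rule n)
    finally have "norm (T - sum ?t ?A) < \<delta>" .
    moreover have "sum ?t ?A \<in> cscale_op.span ?B"
      by (intro cscale_op.span_sum cscale_op.span_scale cscale_op.span_base) auto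
    ultimately show ?thesis by blast
  qed
  ultimately have "approx_dim reduced_group_cstar ball_L \<delta> \<le> enat (cscale_op.dim (cscale_op.span ?B))"
    unfolding approx_dim_def reduced_group_cstar_simps using B
    by (intro Inf_lower CollectI exI[of _ "cscale_op.span ?B"]) auto
  also have "cscale_op.dim (cscale_op.span ?B) \<le> card ?B"
    using B by (intro cscale_op.dim_le_card) auto
  also have "card ?B \<le> card {g. l g \<le> real n}"
    using finite_ball by (rule card_image_le)
  finally show ?thesis by simp
qed

text \<open>The hypothesis on m is an implication over all d, which leaves open how
  \<open>3 / 4\<close> of the cardinality is rounded up to an integer.\<close>

lemma approx_dim_ge:
  assumes N: "1 \<le> N" "4 * real N ^ k * \<delta> \<le> 1"
    and m: "\<And>d. 3 / 4 * real (card {g. l g \<le> real N}) \<le> real d \<Longrightarrow> m \<le> d"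
  shows "enat m \<le> approx_dim reduced_group_cstar ball_L \<delta>"
  unfolding approx_dim_def reduced_group_cstar_simps
proof (rule Inf_greatest, clarify)
  fix B0 :: "('g ell2 \<Rightarrow>\<^sub>L 'g ell2) set"
  let ?Z = "cscale_op.span B0"
  assume B0: "finite B0" and approx: "\<forall>T\<in>ball_L. \<exists>z\<in>?Z. norm (T - z) < \<delta>"
  \<comment> \<open>The given spanning set may be larger than the dimension, which is what has to be
    bounded; hence the passage to a basis.\<close>
  obtain B where B: "B \<subseteq> ?Z" "cscale_op.independent B" "?Z \<subseteq> cscale_op.span B" "card B = cscale_op.dim ?Z"
    using cscale_op.basis_exists[of ?Z] by blast
  have finB: "finite B"
    using cscale_op.independent_span_bound[OF B0 B(2,1)] by blast
  let ?ev = "\<lambda>T :: 'g ell2 \<Rightarrow>\<^sub>L 'g ell2. blinfun_apply T (delta 0)"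
  \<comment> \<open>The 2 keeps \<open>c * l g ^ k\<close> strictly below 1, as the open unit ball
    requires. Dividing by c afterwards turns an error \<delta> into 2 N^k \<delta> \<le>
    1/2.\<close>
  define c where "c = 1 / (2 * real N ^ k)"
  have c: "c > 0" using N(1) by (simp add: c_def)
  have "\<exists>z\<in>cscale.span (?ev ` B). norm (delta g - z) \<le> 1 / 2" if g: "g \<in> {g. l g \<le> real N}" for g
  proof -
    have "norm (lincomb (twist k) (cscale (of_real c) (delta g))) = c * norm (twist k g)"
      using c by (simp add: lincomb_cscale delta_in_Cc norm_cscale_op lincomb_delta)
    also have "\<dots> \<le> c * real N ^ k"
      using norm_twist_le[of k g] power_mono[of "l g" "real N" k] g c l_nonneg[of g]
      by (intro mult_left_mono) auto
    also have "\<dots> < 1" using N(1) by (simp add: c_def)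
    finally have "lreg (cscale (of_real c) (delta g)) \<in> ball_L"
      by (intro unit_ballI Cc_cscale delta_in_Cc)
    then obtain R where R: "R \<in> ?Z" "norm (lreg (cscale (of_real c) (delta g)) - R) < \<delta>"
      using approx by blast
    obtain a where a: "R = (\<Sum>b\<in>B. cscale_op (a b) b)"
      using R(1) B(3) finB by (auto simp: cscale_op.span_finite)
    have "?ev R \<in> cscale.span (?ev ` B)"
      unfolding a blinfun.sum_left cscale_op_apply
      by (intro cscale.span_sum cscale.span_scale cscale.span_base) auto
    then have in_span: "cscale (of_real (inverse c)) (?ev R) \<in> cscale.span (?ev ` B)"
      by (rule cscale.span_scale)
    have "delta g - cscale (of_real (inverse c)) (?ev R)
        = cscale (of_real (inverse c)) (cscale (of_real c) (delta g) - ?ev R)"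
      using c by (simp add: cscale_diff_right)
    also have "cscale (of_real c) (delta g) - ?ev R = ?ev (lreg (cscale (of_real c) (delta g)) - R)"
      by (simp add: blinfun.diff_left lreg_apply_delta Cc_cscale delta_in_Cc)
    finally have "norm (delta g - cscale (of_real (inverse c)) (?ev R))
        = inverse c * norm (?ev (lreg (cscale (of_real c) (delta g)) - R))"
      using c by (simp add: norm_cscale norm_divide norm_inverse)
    also have "\<dots> \<le> inverse c * \<delta>"
      using c R(2) norm_blinfun[of "lreg (cscale (of_real c) (delta g)) - R" "delta 0"]
      by (intro mult_left_mono) auto
    also have "\<dots> \<le> 1 / 2"
      using N(2) by (simp add: c_def)
    finally show ?thesis using in_span by blast
  qed
  then have "3 / 4 * real (card {g. l g \<le> real N}) \<le> real (card (?ev ` B))"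
    using finB finite_ball by (intro card_le_of_approx_delta) auto
  also have "\<dots> \<le> real (card B)"
    using finB by (intro of_nat_mono card_image_le)
  finally have "m \<le> card B" by (rule m)
  then show "enat m \<le> enat (cscale_op.dim ?Z)"
    by (simp add: B(4))
qed

lemma metric_dim_le: "metric_dim reduced_group_cstar (length_seminorm l k) \<le> ereal (2 * r / (2 * real k - r))"
proof -
  \<comment> \<open>The tail bound is \<open>sqrt tail_const\<close> times n to the power -1/s; it
    falls below \<delta> as soon as n exceeds \<open>K * (1 / \<delta>) powr s\<close>, and a ball
    of that radius has O(\<delta>^(-r s)) elements.\<close>
  define s where "s = 2 / (2 * real k - r)"
  have s: "s > 0" using r_less by (simp add: s_def)
  define K where "K = sqrt tail_const powr s"
  have K: "K > 0" using tail_const_pos by (simp add: K_def)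
  have "ln_enat (approx_dim reduced_group_cstar ball_L \<delta>) \<le> ereal (ln (C * (2 + K) powr r) + r * s * ln (1 / \<delta>))"
    if \<delta>: "0 < \<delta>" "\<delta> < 1" for \<delta>
  proof -
    define x where "x = K * (1 / \<delta>) powr s"
    have x: "x > 0" using K \<delta> by (simp add: x_def)
    \<comment> \<open>Adding 1 to the floor makes n exceed x strictly, which the strict inequality
      in the definition of approximation needs, and ensures n \<ge> 1.\<close>
    define n where "n = nat \<lfloor>x\<rfloor> + 1"
    have n: "1 \<le> n" "x < real n" "real n \<le> x + 1"
      using x by (auto simp: n_def) linarith+
    have "sqrt tail_const / \<delta> = x powr (1 / s)"
      using s \<delta> tail_const_pos by (simp add: x_def K_def powr_mult powr_powr)
    also have "\<dots> < real n powr (1 / s)"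
      using n x s by (intro powr_less_mono2) auto
    finally have "sqrt tail_const / \<delta> < real n powr (1 / s)" .
    then have "sqrt tail_const * real n powr (- (1 / s)) < \<delta>"
      using \<delta> n by (simp add: powr_minus field_simps)
    moreover have "sqrt (real n powr (r - 2 * real k)) = real n powr (- (1 / s))"
    proof -
      have "(r - 2 * real k) * (1 / 2) = - (1 / s)"
        by (simp add: s_def field_simps)
      then show ?thesis by (simp only: powr_half_sqrt[symmetric] powr_ge_zero powr_powr)
    qed
    ultimately have "tail_bound n < \<delta>"
      by (simp add: tail_bound_def real_sqrt_mult)
    from approx_dim_le_card_ball[OF n(1) this]
    have "ln_enat (approx_dim reduced_group_cstar ball_L \<delta>) \<le> ereal (ln (C * (1 + real n) powr r))"
      using card_ball_le by (rule ln_enat_le)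
    also have "\<dots> \<le> ereal (ln (C * ((2 + K) * (1 / \<delta>) powr s) powr r))"
    proof -
      \<comment> \<open>This absorbs the additive constant: 1 + n \<le> 2 + x \<le> (2 + K)
        (1/\<delta>)^s.\<close>
      have "1 \<le> (1 / \<delta>) powr s"
        using \<delta> s by (intro ge_one_powr_ge_zero) auto
      then have "1 + real n \<le> (2 + K) * (1 / \<delta>) powr s"
        using n(3) by (simp add: x_def distrib_right)
      then have "C * (1 + real n) powr r \<le> C * ((2 + K) * (1 / \<delta>) powr s) powr r"
        using C_pos r_ge_1 by (intro mult_left_mono powr_mono2) auto
      moreover have "0 < C * (1 + real n) powr r" using C_pos by simp
      ultimately show ?thesis by simp
    qed
    also have "ln (C * ((2 + K) * (1 / \<delta>) powr s) powr r) = ln (C * (2 + K) powr r) + r * s * ln (1 / \<delta>)"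
    proof -
      have "C * ((2 + K) * (1 / \<delta>) powr s) powr r = (C * (2 + K) powr r) * (1 / \<delta>) powr (r * s)"
        using K \<delta> by (simp add: powr_mult powr_powr mult.commute[of s])
      also have "ln \<dots> = ln (C * (2 + K) powr r) + ln ((1 / \<delta>) powr (r * s))"
        using C_pos K \<delta> by (intro ln_mult_pos) auto
      finally show ?thesis using \<delta> by (simp only: ln_powr)
    qed
    finally show ?thesis .
  qed
  from Limsup_le_of_affine_ln[OF this zero_less_one] show ?thesis
    by (simp add: metric_dim_def s_def mult.commute)
qed

lemma metric_dim_ge:
  assumes card_ge: "\<And>n. n + 1 \<le> card {g. l g \<le> real n}"
  shows "ereal (1 / real k) \<le> metric_dim reduced_group_cstar (length_seminorm l k)"
proof -
  have "ereal (ln (3 / 4 * (1 / 4) powr (1 / real k)) + 1 / real k * ln (1 / \<delta>))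
      \<le> ln_enat (approx_dim reduced_group_cstar ball_L \<delta>)"
    if \<delta>: "0 < \<delta>" "\<delta> < 1 / 4" for \<delta>
  proof -
    \<comment> \<open>y solves 4 y^k \<delta> = 1, so its floor N is the largest radius that
      \<open>approx_dim_ge\<close> admits; \<delta> < 1/4 guarantees N \<ge> 1.\<close>
    define y where "y = (1 / (4 * \<delta>)) powr (1 / real k)"
    have y: "1 \<le> y"
      unfolding y_def using \<delta> by (intro ge_one_powr_ge_zero) auto
    define N where "N = nat \<lfloor>y\<rfloor>"
    have N: "1 \<le> N" "real N \<le> y" "y \<le> real N + 1"
      using y by (auto simp: N_def le_nat_iff)
    have "real N ^ k \<le> y ^ k"
      using N by (intro power_mono) auto
    also have "y ^ k = 1 / (4 * \<delta>)"
      using k_pos \<delta> y by (simp add: powr_realpow[symmetric] y_def powr_powr)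
    finally have N4: "4 * real N ^ k * \<delta> \<le> 1"
      using \<delta> by (simp add: field_simps)
    define m where "m = nat \<lceil>3 / 4 * real (card {g. l g \<le> real N})\<rceil>"
    have "enat m \<le> approx_dim reduced_group_cstar ball_L \<delta>"
      using N(1) N4 by (rule approx_dim_ge) (simp add: m_def nat_le_iff ceiling_le_iff)
    moreover have "3 / 4 * y \<le> real m"
    proof -
      \<comment> \<open>The ball has at least N + 1 elements, and the extra one makes up for
        rounding y down to N.\<close>
      have "y \<le> real (card {g. l g \<le> real N})"
        using N(3) card_ge[of N] by linarith
      then have "3 / 4 * y \<le> 3 / 4 * real (card {g. l g \<le> real N})" by simp
      also have "\<dots> \<le> real m" unfolding m_def by (rule real_nat_ceiling_ge)
      finally show ?thesis .
    qed
    ultimately have "ereal (ln (3 / 4 * y)) \<le> ln_enat (approx_dim reduced_group_cstar ball_L \<delta>)"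
      using y by (intro ln_enat_ge) auto
    moreover have "ln (3 / 4 * y) = ln (3 / 4 * (1 / 4) powr (1 / real k)) + 1 / real k * ln (1 / \<delta>)"
    proof -
      have "y = (1 / 4) powr (1 / real k) * (1 / \<delta>) powr (1 / real k)"
        unfolding y_def using \<delta> by (simp add: powr_mult[symmetric])
      then have "3 / 4 * y = (3 / 4 * (1 / 4) powr (1 / real k)) * (1 / \<delta>) powr (1 / real k)"
        by (simp only: mult.assoc)
      also have "ln \<dots> = ln (3 / 4 * (1 / 4) powr (1 / real k)) + ln ((1 / \<delta>) powr (1 / real k))"
        using \<delta> by (intro ln_mult_pos) auto
      finally show ?thesis using \<delta> by (simp only: ln_powr)
    qed
    ultimately show ?thesis by simp
  qed
  then show ?thesis
    unfolding metric_dim_def by (rule Limsup_ge_of_affine_ln[where e = "1 / 4"]) auto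
qed

end

theorem theorem3p1:
  fixes S :: "'g::group_add set" and r :: real and k :: nat
  assumes "infinite (UNIV :: 'g set)"
    and "finite S" and "generates_group S"
    and "r \<ge> 1" and "polynomial_growth (word_length S) r"
    and "real k > r / 2"
  shows "compact_quantum_metric_space reduced_group_cstar (length_seminorm (word_length S) k) \<and>
    ereal (1 / real k) \<le> metric_dim reduced_group_cstar (length_seminorm (word_length S) k) \<and>
    metric_dim reduced_group_cstar (length_seminorm (word_length S) k)
      \<le> ereal (2 * r / (2 * real k - r))"
proof -
  obtain C where C: "C > 0"
    "\<And>n::nat. finite {g. word_length S g \<le> real n}"
    "\<And>n::nat. real (card {g. word_length S g \<le> real n}) \<le> C * (1 + real n) powr r"
    using assms(5) unfolding polynomial_growth_def by blast
  interpret length_function "word_length S"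
    using assms(3) by (rule length_function_word_length)
  interpret growth "word_length S" C r k
    using C assms(4,6) by unfold_locales auto
  show ?thesis
    using compact_quantum_metric_space_length_seminorm metric_dim_le
      metric_dim_ge[OF card_word_ball_ge[OF assms(1,3) C(2)]] by blast
qed

end
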